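(* Let $X,S$ be finite sets and let $G$ be an infinite connected $(X,S)$-graph with bounded vertex degrees which is an antiexpander with uniform patch frequency (a UPF-antiexpander). Let $A:V(G)\times V(G)\to\mathbb{R}$ be a self-adjoint finite range pattern-invariant operator on $G$. Then there exists a monotone right-continuous function $\sigma_A:\mathbb{R}\to\mathbb{R}$ such that for every F{\o}lner sequence $\{G_n\}_{n=1}^\infty$ of $G$, the normalized spectral distribution functions $N_{A_n}$ of the finite volume approximations $A_n$ of $A$ on $G_n$ converge uniformly on $\mathbb{R}$ to $\sigma_A$. In particular the limit does not depend on the choice of the F{\o}lner sequence.
   Context: **$(X,S)$-graphs.** An $(X,S)$-graph is a simple graph whose vertices are colored by elements of $X$ and whose directed edges are colored by elements of $S$ (for each edge, both directed edges $\overrightarrow{(x,y)}$ and $\overrightarrow{(y,x)}$ get a color). $d_G$ is the shortest path distance and $B_r(x)$ is the subgraph spanned by the vertices at distance at most $r$ from $x$, regarded as a colored graph rooted at $x$. Rooted isomorphisms are graph isomorphisms mapping root to root and preserving vertex- and edge-colorings. **Weak convergence.** Let $\mathcal{A}(d,r,X,S)$ be the finite set of rooted isomorphism classes of finite connected rooted $(X,S)$-graphs with all degrees $\le d$ and all vertices at distance $\le r$ from the root. For a finite $(X,S)$-graph $H$ with degrees at most $d$ and $\alpha\in\mathcal{A}(d,r,X,S)$ let $p_H(\alpha)=|\{z\in V(H): B_r(z) \text{ (in } H) \text{ represents } \alpha\}|/|V(H)|$. A sequence $\{G_n\}$ of finite connected $(X,S)$-graphs with degrees at most $d$ and $|V(G_n)|\to\infty$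 is weakly convergent if $\lim_{n\to\infty}p_{G_n}(\alpha)$ exists for every $r\ge1$ and $\alpha\in\mathcal{A}(d,r,X,S)$. **Antiexpander sequences.** A sequence $\{G_n\}$ of finite connected graphs with degrees at most $d$ is an antiexpander if for every $\epsilon>0$ there is $K_\epsilon>0$ such that for every $n\ge1$ one can remove at most $\epsilon|E(G_n)|$ edges from $G_n$ so that every component of the remaining graph has at most $K_\epsilon$ vertices. **F{\o}lner sequences.** For a spanned (induced) subgraph $H$ of $G$, $\partial H=\{x\in V(H): \exists y\in V(G)\setminus V(H),\ (x,y)\in E(G)\}$. A F{\o}lner sequence of $G$ is a sequence of finite connected spanned subgraphs $\{G_n\}$ with $\lim_{n\to\infty}|\partial G_n|/|V(G_n)|=0$. $G$ is amenable if it has a F{\o}lner sequence. **UPF-antiexpander.** $G$ is a UPF-antiexpander if it is amenable, every F{\o}lner sequence of $G$ is weakly convergent (uniform patch frequency, UPF), and every F{\o}lner sequence of $G$ is an antiexpander sequence. **Operators.** An operator kernel $A:V(G)\times V(G)\to\mathbb{R}$ acts by $Af(x)=\sum_{y}A(x,y)f(y)$. It is a finite range pattern-invariant operator if there is $s_A$ such that $A(x,y)=0$ whenever $d_G(x,y)>s_A$, and $A(x,y)=A(\phi(x),\phi(y))$ for every rooted color isomorphism $\phi$ from $B_{s_A}(x)$ to $B_{s_A}(\phi(x))$ and every vertex $y$ of $B_{s_A}(x)$. Self-adjoint means $A(x,y)=A(y,x)$. The finite volume approximation of $A$ on a finite spanned subgraph $G_n$ is the operator on $L^2(V(G_n))$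 with kernel $A_n(x,y)=A(x,y)$, $x,y\in V(G_n)$. For a self-adjoint operator $B$ on $L^2(V)$, $V$ finite, $N_B(\lambda)$ is the number of eigenvalues of $B$ (with multiplicity) not larger than $\lambda$, divided by $|V|$. *)

theory Defs
  imports "HOL-Analysis.Analysis" "HOL-Library.Function_Algebras"
begin

section \<open>Colored graphs\<close>

text \<open>A simple graph is stored as a symmetric irreflexive set of directed edges, so that the two
  orientations of an edge carry separate colors. The coloring functions are total; only their
  values on vertices and on directed edges are meaningful.\<close>

record ('v, 'x, 's) xs_graph =
  verts :: "'v set"
  edges :: "('v \<times> 'v) set"
  vcol :: "'v \<Rightarrow> 'x"
  ecol :: "'v \<times> 'v \<Rightarrow> 's"

definition is_xs_graph :: "'x set \<Rightarrow> 's set \<Rightarrow> ('v, 'x, 's) xs_graph \<Rightarrow> bool" where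
  "is_xs_graph X S G \<longleftrightarrow>
     edges G \<subseteq> verts G \<times> verts G \<and> sym (edges G) \<and> irrefl (edges G) \<and>
     vcol G ` verts G \<subseteq> X \<and> ecol G ` edges G \<subseteq> S"

definition degrees_le :: "nat \<Rightarrow> ('v, 'x, 's) xs_graph \<Rightarrow> bool" where
  "degrees_le d G \<longleftrightarrow>
     (\<forall>x\<in>verts G. finite {y. (x, y) \<in> edges G} \<and> card {y. (x, y) \<in> edges G} \<le> d)"

text \<open>Connected graphs are nonempty by convention.\<close>

definition connected_graph :: "('v, 'x, 's) xs_graph \<Rightarrow> bool" where
  "connected_graph G \<longleftrightarrow>
     verts G \<noteq> {} \<and> (\<forall>x\<in>verts G. \<forall>y\<in>verts G. (x, y) \<in> (edges G)\<^sup>*)"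

text \<open>The distance is \<open>\<infinity>\<close> when no path exists.\<close>

definition gdist :: "('v, 'x, 's) xs_graph \<Rightarrow> 'v \<Rightarrow> 'v \<Rightarrow> enat" where
  "gdist G x y = Inf {enat k |k. (x, y) \<in> edges G ^^ k}"

definition spanned :: "('v, 'x, 's) xs_graph \<Rightarrow> 'v set \<Rightarrow> ('v, 'x, 's) xs_graph" where
  "spanned G W = G\<lparr>verts := W, edges := edges G \<inter> W \<times> W\<rparr>"

definition spanned_subgraph :: "('v, 'x, 's) xs_graph \<Rightarrow> ('v, 'x, 's) xs_graph \<Rightarrow> bool" where
  "spanned_subgraph H G \<longleftrightarrow> verts H \<subseteq> verts G \<and> H = spanned G (verts H)"

definition gball :: "('v, 'x, 's) xs_graph \<Rightarrow> nat \<Rightarrow> 'v \<Rightarrow> ('v, 'x, 's) xs_graph" where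
  "gball G r x = spanned G {y \<in> verts G. gdist G x y \<le> enat r}"


section \<open>Patches and weak convergence\<close>

definition rooted_iso ::
  "('v \<Rightarrow> 'w) \<Rightarrow> ('v, 'x, 's) xs_graph \<times> 'v \<Rightarrow> ('w, 'x, 's) xs_graph \<times> 'w \<Rightarrow> bool" where
  "rooted_iso \<phi> P Q \<longleftrightarrow> (case (P, Q) of ((G, x), (H, y)) \<Rightarrow>
     bij_betw \<phi> (verts G) (verts H) \<and> \<phi> x = y \<and>
     (\<forall>u\<in>verts G. \<forall>v\<in>verts G. (u, v) \<in> edges G \<longleftrightarrow> (\<phi> u, \<phi> v) \<in> edges H) \<and>
     (\<forall>u\<in>verts G. vcol H (\<phi> u) = vcol G u) \<and>
     (\<forall>(u, v)\<in>edges G. ecol H (\<phi> u, \<phi> v) = ecol G (u, v)))"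

text \<open>Isomorphism classes of finite rooted graphs are taken among graphs whose vertices are natural
  numbers; every finite graph has such a copy.\<close>

definition rooted_graphs ::
  "nat \<Rightarrow> nat \<Rightarrow> 'x set \<Rightarrow> 's set \<Rightarrow> ((nat, 'x, 's) xs_graph \<times> nat) set" where
  "rooted_graphs d r X S = {(H, x). is_xs_graph X S H \<and> finite (verts H) \<and> connected_graph H \<and>
     degrees_le d H \<and> x \<in> verts H \<and> (\<forall>y\<in>verts H. gdist H x y \<le> enat r)}"

definition patches ::
  "nat \<Rightarrow> nat \<Rightarrow> 'x set \<Rightarrow> 's set \<Rightarrow> ((nat, 'x, 's) xs_graph \<times> nat) set set" where
  "patches d r X S = rooted_graphs d r X S //
     {(P, Q) \<in> rooted_graphs d r X S \<times> rooted_graphs d r X S. \<exists>\<phi>. rooted_iso \<phi> P Q}"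

definition represents ::
  "('v, 'x, 's) xs_graph \<times> 'v \<Rightarrow> ((nat, 'x, 's) xs_graph \<times> nat) set \<Rightarrow> bool" where
  "represents P \<alpha> \<longleftrightarrow> (\<exists>Q\<in>\<alpha>. \<exists>\<phi>. rooted_iso \<phi> P Q)"

definition patch_freq ::
  "nat \<Rightarrow> ('v, 'x, 's) xs_graph \<Rightarrow> ((nat, 'x, 's) xs_graph \<times> nat) set \<Rightarrow> real" where
  "patch_freq r H \<alpha> =
     real (card {z \<in> verts H. represents (gball H r z, z) \<alpha>}) / real (card (verts H))"

definition weakly_convergent ::
  "nat \<Rightarrow> 'x set \<Rightarrow> 's set \<Rightarrow> (nat \<Rightarrow> ('v, 'x, 's) xs_graph) \<Rightarrow> bool" where
  "weakly_convergent d X S Gn \<longleftrightarrow>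
     (\<forall>n. is_xs_graph X S (Gn n) \<and> finite (verts (Gn n)) \<and> connected_graph (Gn n) \<and>
          degrees_le d (Gn n)) \<and>
     filterlim (\<lambda>n. card (verts (Gn n))) at_top sequentially \<and>
     (\<forall>r\<ge>1. \<forall>\<alpha>\<in>patches d r X S. convergent (\<lambda>n. patch_freq r (Gn n) \<alpha>))"


section \<open>Antiexpanders and Folner sequences\<close>

definition undirected_edges :: "('v, 'x, 's) xs_graph \<Rightarrow> 'v set set" where
  "undirected_edges G = {{x, y} |x y. (x, y) \<in> edges G}"

definition remove_edges :: "('v, 'x, 's) xs_graph \<Rightarrow> 'v set set \<Rightarrow> ('v, 'x, 's) xs_graph" where
  "remove_edges G F = G\<lparr>edges := {(x, y) \<in> edges G. {x, y} \<notin> F}\<rparr>"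

definition component_of :: "('v, 'x, 's) xs_graph \<Rightarrow> 'v \<Rightarrow> 'v set" where
  "component_of G x = {y \<in> verts G. (x, y) \<in> (edges G)\<^sup>*}"

definition antiexpander :: "nat \<Rightarrow> (nat \<Rightarrow> ('v, 'x, 's) xs_graph) \<Rightarrow> bool" where
  "antiexpander d Gn \<longleftrightarrow>
     (\<forall>n. finite (verts (Gn n)) \<and> connected_graph (Gn n) \<and> degrees_le d (Gn n)) \<and>
     (\<forall>\<epsilon>>0. \<exists>K>0. \<forall>n. \<exists>F\<subseteq>undirected_edges (Gn n).
        real (card F) \<le> \<epsilon> * real (card (undirected_edges (Gn n))) \<and>
        (\<forall>x\<in>verts (Gn n). card (component_of (remove_edges (Gn n) F) x) \<le> K))"

definition boundary :: "('v, 'x, 's) xs_graph \<Rightarrow> ('v, 'x, 's) xs_graph \<Rightarrow> 'v set" where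
  "boundary G H = {x \<in> verts H. \<exists>y \<in> verts G - verts H. (x, y) \<in> edges G}"

definition folner_sequence ::
  "('v, 'x, 's) xs_graph \<Rightarrow> (nat \<Rightarrow> ('v, 'x, 's) xs_graph) \<Rightarrow> bool" where
  "folner_sequence G Gn \<longleftrightarrow>
     (\<forall>n. spanned_subgraph (Gn n) G \<and> finite (verts (Gn n)) \<and> connected_graph (Gn n)) \<and>
     (\<lambda>n. real (card (boundary G (Gn n))) / real (card (verts (Gn n)))) \<longlonglongrightarrow> 0"

definition amenable :: "('v, 'x, 's) xs_graph \<Rightarrow> bool" where
  "amenable G \<longleftrightarrow> (\<exists>Gn. folner_sequence G Gn)"

definition upf_antiexpander ::
  "nat \<Rightarrow> 'x set \<Rightarrow> 's set \<Rightarrow> ('v, 'x, 's) xs_graph \<Rightarrow> bool" where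
  "upf_antiexpander d X S G \<longleftrightarrow> amenable G \<and>
     (\<forall>Gn. folner_sequence G Gn \<longrightarrow> weakly_convergent d X S Gn) \<and>
     (\<forall>Gn. folner_sequence G Gn \<longrightarrow> antiexpander d Gn)"


section \<open>Operators and spectral distribution functions\<close>

definition finite_range_pattern_invariant ::
  "('v, 'x, 's) xs_graph \<Rightarrow> ('v \<Rightarrow> 'v \<Rightarrow> real) \<Rightarrow> bool" where
  "finite_range_pattern_invariant G A \<longleftrightarrow> (\<exists>s::nat.
     (\<forall>x\<in>verts G. \<forall>y\<in>verts G. gdist G x y > enat s \<longrightarrow> A x y = 0) \<and>
     (\<forall>x\<in>verts G. \<forall>x'\<in>verts G. \<forall>\<phi>. rooted_iso \<phi> (gball G s x, x) (gball G s x', x') \<longrightarrow>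
        (\<forall>y\<in>verts (gball G s x). A x y = A (\<phi> x) (\<phi> y))))"

definition self_adjoint_kernel :: "('v, 'x, 's) xs_graph \<Rightarrow> ('v \<Rightarrow> 'v \<Rightarrow> real) \<Rightarrow> bool" where
  "self_adjoint_kernel G A \<longleftrightarrow> (\<forall>x\<in>verts G. \<forall>y\<in>verts G. A x y = A y x)"

text \<open>For a finite set \<open>V\<close>, the space \<open>L\<^sup>2(V)\<close> is realized as the real functions vanishing outside
  \<open>V\<close>, a subspace of the space of all functions with pointwise operations.\<close>

definition fun_scale :: "real \<Rightarrow> ('v \<Rightarrow> real) \<Rightarrow> 'v \<Rightarrow> real" where
  "fun_scale c f = (\<lambda>x. c * f x)"

interpretation fun_space: vector_space fun_scale
  by unfold_locales (auto simp: fun_scale_def fun_eq_iff algebra_simps)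

definition L2 :: "'v set \<Rightarrow> ('v \<Rightarrow> real) set" where
  "L2 V = {f. \<forall>x. x \<notin> V \<longrightarrow> f x = 0}"

text \<open>The finite volume approximation on a finite spanned subgraph, as an operator on its
  \<open>L\<^sup>2\<close> space.\<close>

definition finite_volume ::
  "('v \<Rightarrow> 'v \<Rightarrow> real) \<Rightarrow> ('v, 'x, 's) xs_graph \<Rightarrow> ('v \<Rightarrow> real) \<Rightarrow> 'v \<Rightarrow> real" where
  "finite_volume A H f = (\<lambda>x. if x \<in> verts H then \<Sum>y\<in>verts H. A x y * f y else 0)"

definition eigenspace :: "'v set \<Rightarrow> (('v \<Rightarrow> real) \<Rightarrow> 'v \<Rightarrow> real) \<Rightarrow> real \<Rightarrow> ('v \<Rightarrow> real) set" where
  "eigenspace V B \<mu> = {f \<in> L2 V. B f = fun_scale \<mu> f}"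

definition eigenvalues :: "'v set \<Rightarrow> (('v \<Rightarrow> real) \<Rightarrow> 'v \<Rightarrow> real) \<Rightarrow> real set" where
  "eigenvalues V B = {\<mu>. \<exists>f\<in>eigenspace V B \<mu>. f \<noteq> 0}"

text \<open>Multiplicities are dimensions of eigenspaces; the operators considered are self-adjoint.\<close>

definition spectral_distribution ::
  "'v set \<Rightarrow> (('v \<Rightarrow> real) \<Rightarrow> 'v \<Rightarrow> real) \<Rightarrow> real \<Rightarrow> real" where
  "spectral_distribution V B t =
     real (\<Sum>\<mu>\<in>{\<mu> \<in> eigenvalues V B. \<mu> \<le> t}. fun_space.dim (eigenspace V B \<mu>)) / real (card V)"

end

theory Submission
  imports Defs
begin

text \<open>
  By UPF the patch frequencies of a Folner sequence converge, so the normalized traces of all powers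
  of the finite volume approximations converge: away from a negligible boundary, a diagonal entry of
  a power of \<open>A\<close> is determined by the patch around the vertex (\<open>trace_convergent\<close>). Hence the averages
  of every continuous function over the spectra converge.

  This gives convergence of the spectral distribution functions only at continuity points of the
  limit. The antiexpander property provides the uniformity. Deleting a small proportion of the edges
  cuts the graphs into components of bounded size, and dropping the entries of \<open>A\<close> between different
  components changes the normalized eigenvalue counts only slightly, uniformly in the level
  (\<open>eigenvalue_count_perturbation\<close>). The remaining kernel is a direct sum of symmetric matrices of
  bounded size, and their entries are among the finitely many values of \<open>A\<close>
  (\<open>finite_values\<close>). So all its eigenvalues are in one finite set \<open>\<Lambda>\<close> that does not depend on the
  member of the sequence (\<open>gap_condition\<close>). Up to a small error the distribution functions are thus
  step functions jumping only in \<open>\<Lambda>\<close>, and their values on the finitely many steps are approximated by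
  averages of continuous functions, which converge. The sequence is therefore uniformly Cauchy
  (\<open>ecdf_uniform_limit_exists\<close>).

  Finally, two Folner sequences can be interleaved to a Folner sequence, so their limits agree.
\<close>

section \<open>Diagonalization of symmetric kernels\<close>

text \<open>A homogeneous linear system with more unknowns than equations has a nontrivial solution. The
  comparisons of dimensions below reduce to this.\<close>

lemma homogeneous_system:
  fixes a :: "'j \<Rightarrow> 'i \<Rightarrow> real"
  assumes "finite J" "finite I" "card J < card I"
  shows "\<exists>c. (\<exists>i\<in>I. c i \<noteq> 0) \<and> (\<forall>j\<in>J. (\<Sum>i\<in>I. a j i * c i) = 0)"
  using assms
proof (induction J arbitrary: I a rule: finite_induct)
  case empty
  then obtain i where "i \<in> I" by (metis card.empty card_gt_0_iff ex_in_conv)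
  then show ?case by (intro exI[of _ "\<lambda>_. 1"]) auto
next
  case (insert j J)
  show ?case
  proof (cases "\<exists>p\<in>I. a j p \<noteq> 0")
    case False
    have "card J < card I" using insert by auto
    from insert.IH[OF insert.prems(1) this, of a] obtain c where
      "\<exists>i\<in>I. c i \<noteq> 0" "\<forall>j\<in>J. (\<Sum>i\<in>I. a j i * c i) = 0" by blast
    with False show ?thesis by (intro exI[of _ c]) auto
  next
    case True
    then obtain p where p: "p \<in> I" "a j p \<noteq> 0" by blast
    let ?I = "I - {p}"
    have "card J < card ?I" "finite ?I" using insert p by auto
    from insert.IH[OF this(2,1), of "\<lambda>k i. a k i - a k p * a j i / a j p"] obtain c where
      c: "\<exists>i\<in>?I. c i \<noteq> 0"
        "\<forall>k\<in>J. (\<Sum>i\<in>?I. (a k i - a k p * a j i / a j p) * c i) = 0" by blast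
    define s where "s = (\<Sum>i\<in>?I. a j i * c i)"
    \<comment> \<open>The unknown \<open>p\<close> is eliminated from the other equations by means of equation \<open>j\<close>.\<close>
    define c' where "c' = c(p := - s / a j p)"
    have sum_c': "(\<Sum>i\<in>I. a k i * c' i) = (\<Sum>i\<in>?I. a k i * c i) - a k p * s / a j p" for k
    proof -
      have "(\<Sum>i\<in>I. a k i * c' i) = a k p * c' p + (\<Sum>i\<in>?I. a k i * c' i)"
        using p insert.prems by (subst sum.remove[of I p]) auto
      also have "(\<Sum>i\<in>?I. a k i * c' i) = (\<Sum>i\<in>?I. a k i * c i)"
        by (rule sum.cong) (auto simp: c'_def)
      finally show ?thesis by (simp add: c'_def)
    qed
    have "(\<Sum>i\<in>I. a j i * c' i) = 0" using sum_c'[of j] p by (simp add: s_def)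
    moreover have "(\<Sum>i\<in>I. a k i * c' i) = 0" if "k \<in> J" for k
    proof -
      have "0 = (\<Sum>i\<in>?I. (a k i - a k p * a j i / a j p) * c i)" using c(2) that by simp
      also have "\<dots> = (\<Sum>i\<in>?I. a k i * c i - a k p / a j p * (a j i * c i))"
        by (intro sum.cong) (auto simp: left_diff_distrib)
      also have "\<dots> = (\<Sum>i\<in>?I. a k i * c i) - a k p / a j p * s"
        by (simp add: sum_subtractf sum_distrib_left s_def)
      finally show ?thesis using sum_c'[of k] by simp
    qed
    moreover have "\<exists>i\<in>I. c' i \<noteq> 0" using c(1) by (auto simp: c'_def)
    ultimately show ?thesis by (intro exI[of _ c']) auto
  qed
qed

text \<open>The inner product of \<open>L\<^sup>2(V)\<close>; its arguments need not vanish outside \<open>V\<close>.\<close>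

definition inner_on :: "'v set \<Rightarrow> ('v \<Rightarrow> real) \<Rightarrow> ('v \<Rightarrow> real) \<Rightarrow> real" where
  "inner_on V f g = (\<Sum>x\<in>V. f x * g x)"

text \<open>The operator on \<open>L\<^sup>2(V)\<close> with kernel \<open>K\<close>, cut off outside \<open>V\<close>. Finite volume
  approximations are of this form, see \<open>finite_volume_eq_kernel_op\<close> below.\<close>

definition kernel_op :: "'v set \<Rightarrow> ('v \<Rightarrow> 'v \<Rightarrow> real) \<Rightarrow> ('v \<Rightarrow> real) \<Rightarrow> 'v \<Rightarrow> real" where
  "kernel_op V K f = (\<lambda>x. if x \<in> V then \<Sum>y\<in>V. K x y * f y else 0)"

lemma inner_on_commute: "inner_on V f g = inner_on V g f"
  by (simp add: inner_on_def mult.commute)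

lemma inner_on_add_left: "inner_on V (\<lambda>x. f x + g x) h = inner_on V f h + inner_on V g h"
  by (simp add: inner_on_def distrib_right sum.distrib)

lemma inner_on_add_right: "inner_on V h (\<lambda>x. f x + g x) = inner_on V h f + inner_on V h g"
  by (simp add: inner_on_def distrib_left sum.distrib)

lemma inner_on_scale_left: "inner_on V (\<lambda>x. c * f x) h = c * inner_on V f h"
  by (simp add: inner_on_def sum_distrib_left mult.assoc)

lemma inner_on_scale_right: "inner_on V h (\<lambda>x. c * f x) = c * inner_on V h f"
  by (simp add: inner_on_def sum_distrib_left algebra_simps)

lemma inner_on_sum_left: "inner_on V (\<lambda>x. \<Sum>i\<in>I. c i * f i x) h = (\<Sum>i\<in>I. c i * inner_on V (f i) h)"
  unfolding inner_on_def sum_distrib_left sum_distrib_right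
  by (subst sum.swap) (simp add: mult.assoc)

lemma inner_on_self_nonneg: "0 \<le> inner_on V f f"
  by (simp add: inner_on_def sum_nonneg)

lemma inner_on_self_pos:
  assumes "finite V" "x \<in> V" "f x \<noteq> 0"
  shows "0 < inner_on V f f"
  unfolding inner_on_def using assms
  by (intro sum_pos2[of V x]) (auto simp: zero_less_mult_iff linorder_neq_iff)

lemma kernel_op_symmetric:
  assumes "\<forall>x\<in>V. \<forall>y\<in>V. K x y = K y x"
  shows "inner_on V (kernel_op V K f) g = inner_on V f (kernel_op V K g)"
proof -
  have "inner_on V (kernel_op V K f) g = (\<Sum>x\<in>V. \<Sum>y\<in>V. K x y * f y * g x)"
    by (simp add: inner_on_def kernel_op_def sum_distrib_right)
  also have "\<dots> = (\<Sum>y\<in>V. \<Sum>x\<in>V. K x y * f y * g x)" by (rule sum.swap)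
  also have "\<dots> = (\<Sum>y\<in>V. \<Sum>x\<in>V. f y * (K y x * g x))"
    using assms by (intro sum.cong refl) (simp add: mult_ac)
  also have "\<dots> = inner_on V f (kernel_op V K g)"
    by (simp add: inner_on_def kernel_op_def sum_distrib_left)
  finally show ?thesis .
qed

lemma kernel_op_add: "kernel_op V K (\<lambda>x. f x + g x) = (\<lambda>x. kernel_op V K f x + kernel_op V K g x)"
  by (auto simp: kernel_op_def distrib_left sum.distrib)

lemma kernel_op_scale: "kernel_op V K (\<lambda>x. c * f x) = (\<lambda>x. c * kernel_op V K f x)"
  by (auto simp: kernel_op_def sum_distrib_left algebra_simps)

lemma kernel_op_sum: "kernel_op V K (\<lambda>x. \<Sum>i\<in>I. c i * f i x) = (\<lambda>x. \<Sum>i\<in>I. c i * kernel_op V K (f i) x)"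
proof
  fix x
  show "kernel_op V K (\<lambda>x. \<Sum>i\<in>I. c i * f i x) x = (\<Sum>i\<in>I. c i * kernel_op V K (f i) x)"
  proof (cases "x \<in> V")
    case True
    have "kernel_op V K (\<lambda>x. \<Sum>i\<in>I. c i * f i x) x = (\<Sum>y\<in>V. \<Sum>i\<in>I. c i * (K x y * f i y))"
      using True by (simp add: kernel_op_def sum_distrib_left algebra_simps)
    also have "\<dots> = (\<Sum>i\<in>I. \<Sum>y\<in>V. c i * (K x y * f i y))" by (rule sum.swap)
    finally show ?thesis using True by (simp add: kernel_op_def sum_distrib_left)
  qed (simp add: kernel_op_def)
qed

lemma kernel_op_L2: "kernel_op V K f \<in> L2 V"
  by (simp add: kernel_op_def L2_def)

lemma inner_on_self_eq_0: "finite V \<Longrightarrow> inner_on V f f = 0 \<Longrightarrow> x \<in> V \<Longrightarrow> f x = 0"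
  using inner_on_self_pos[of V x f] by force

text \<open>The eigenvector is a maximizer \<open>f\<close> of the quadratic form on the unit sphere of the orthogonal
  complement \<open>U\<close> of the given eigenvectors. The sphere is compact in the product topology, being a
  closed subset of a product of compact intervals. If \<open>\<mu>\<close> is the maximum, then
  \<open>\<mu> \<langle>g, g\<rangle> - \<langle>K g, g\<rangle>\<close> is a positive semidefinite form on \<open>U\<close> vanishing at \<open>f\<close>, so \<open>f\<close> is in its
  radical; as \<open>\<mu> f - K f\<close> is itself in \<open>U\<close>, it is zero.\<close>

lemma eigenvector_in_orthogonal_complement:
  fixes K :: "'v \<Rightarrow> 'v \<Rightarrow> real" and e :: "nat \<Rightarrow> 'v \<Rightarrow> real"
  assumes V: "finite V"
    and sym: "\<forall>x\<in>V. \<forall>y\<in>V. K x y = K y x"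
    and eig: "\<And>i. i < k \<Longrightarrow> kernel_op V K (e i) = (\<lambda>x. l i * e i x)"
    and k: "k < card V"
  shows "\<exists>f \<mu>. f \<in> L2 V \<and> inner_on V f f = 1 \<and> (\<forall>i<k. inner_on V f (e i) = 0) \<and>
    kernel_op V K f = (\<lambda>x. \<mu> * f x)"
proof -
  define U where "U = {f \<in> L2 V. \<forall>i<k. inner_on V f (e i) = 0}"
  define B where "B = {f \<in> U. inner_on V f f = 1}"
  define q where "q f = inner_on V (kernel_op V K f) f" for f
  have U_scale: "(\<lambda>x. c * f x) \<in> U" if "f \<in> U" for f c
    using that by (auto simp: U_def L2_def inner_on_scale_left)
  have U_add: "(\<lambda>x. f x + g x) \<in> U" if "f \<in> U" "g \<in> U" for f g
    using that by (auto simp: U_def L2_def inner_on_add_left)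
  have U_kernel_op: "kernel_op V K f \<in> U" if "f \<in> U" for f
    using that by (auto simp: U_def kernel_op_L2 kernel_op_symmetric[OF sym] eig inner_on_scale_right)
  have "card {..<k} < card V" using k by simp
  from homogeneous_system[OF _ V this, of e] obtain c where
    c: "\<exists>x\<in>V. c x \<noteq> 0" "\<forall>i<k. (\<Sum>x\<in>V. e i x * c x) = 0" by auto
  define c' where "c' = (\<lambda>x. if x \<in> V then c x else 0)"
  have c'U: "c' \<in> U"
    using c by (auto simp: U_def c'_def L2_def inner_on_def mult.commute)
  have c'pos: "0 < inner_on V c' c'"
    using c inner_on_self_pos[OF V] by (metis c'_def)
  have normalize: "(\<lambda>x. 1 / sqrt (inner_on V g g) * g x) \<in> B" if "g \<in> U" "0 < inner_on V g g" for g
  proof -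
    have "inner_on V (\<lambda>x. 1 / sqrt (inner_on V g g) * g x) (\<lambda>x. 1 / sqrt (inner_on V g g) * g x) =
        (1 / sqrt (inner_on V g g))\<^sup>2 * inner_on V g g"
      unfolding inner_on_scale_left inner_on_scale_right power2_eq_square
      by (rule mult.assoc[symmetric])
    also have "\<dots> = 1" using that(2) by (simp add: power_divide)
    finally show ?thesis using U_scale[OF that(1)] by (simp only: B_def mem_Collect_eq)
  qed
  have "B \<noteq> {}" using normalize[OF c'U c'pos] by blast
  have contV: "continuous_on UNIV (\<lambda>f::'v \<Rightarrow> real. f x)" for x
    by (rule continuous_on_product_coordinates)
  have cont_ip: "continuous_on UNIV (\<lambda>f. inner_on V f g)" for g
    unfolding inner_on_def by (intro continuous_intros contV)
  have cont_ip2: "continuous_on UNIV (\<lambda>f. inner_on V f f)"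
    unfolding inner_on_def by (intro continuous_intros contV)
  have cont_q: "continuous_on UNIV q"
    unfolding q_def inner_on_def kernel_op_def by (simp, intro continuous_intros contV)
  have "B = (\<Inter>x\<in>-V. {f. f x = 0}) \<inter> (\<Inter>i\<in>{..<k}. {f. inner_on V f (e i) = 0}) \<inter> {f. inner_on V f f = 1}"
    by (auto simp: B_def U_def L2_def)
  also have "closed \<dots>"
    by (intro closed_Int closed_INT ballI closed_Collect_eq contV cont_ip cont_ip2 continuous_on_const)
  finally have "closed B" .
  define box where "box = (Pi\<^sub>E UNIV (\<lambda>x. if x \<in> V then {-1..1::real} else {0}))"
  have "compactin (product_topology (\<lambda>_. euclidean) UNIV) box"
    unfolding box_def by (subst compactin_PiE) auto
  then have "compact box"
    by (simp add: euclidean_product_topology)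
  moreover have "B \<subseteq> box"
  proof
    fix f assume f: "f \<in> B"
    have "f x * f x \<le> 1" if "x \<in> V" for x
      using f member_le_sum[of x V "\<lambda>x. f x * f x"] that V by (auto simp: B_def inner_on_def)
    then have "\<bar>f x\<bar> \<le> 1" if "x \<in> V" for x
      using that by (metis abs_square_le_1 power2_eq_square)
    then show "f \<in> box" using f by (auto simp: box_def B_def U_def L2_def abs_le_iff)
  qed
  ultimately have "compact B"
    using \<open>closed B\<close> compact_Int_closed[of box B] by (simp add: Int_absorb1)
  from continuous_attains_sup[OF this \<open>B \<noteq> {}\<close> continuous_on_subset[OF cont_q]]
  obtain f where f: "f \<in> B" "\<And>g. g \<in> B \<Longrightarrow> q g \<le> q f" by auto
  define \<mu> where "\<mu> = q f"
  define P where "P g h = \<mu> * inner_on V g h - inner_on V (kernel_op V K g) h" for g h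
  have q_scale: "q (\<lambda>x. c * g x) = c * c * q g" for c g
    by (simp add: q_def kernel_op_scale inner_on_scale_left inner_on_scale_right)
  have Pnonneg: "0 \<le> P g g" if "g \<in> U" for g
  proof (cases "inner_on V g g = 0")
    case True
    then have z: "g x = 0" if "x \<in> V" for x using inner_on_self_eq_0[OF V] that by blast
    have "q g = 0" unfolding q_def inner_on_def using z by simp
    then show ?thesis using True by (simp add: P_def q_def)
  next
    case False
    then have pos: "0 < inner_on V g g" using inner_on_self_nonneg[of V g] by linarith
    define c where "c = 1 / sqrt (inner_on V g g)"
    have cc: "c * c = 1 / inner_on V g g" using pos by (simp add: c_def)
    have "(\<lambda>x. c * g x) \<in> B" unfolding c_def by (rule normalize[OF that pos])
    then have "c * c * q g \<le> \<mu>" using f(2) q_scale unfolding \<mu>_def by metis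
    then show ?thesis using pos unfolding cc P_def q_def by (simp add: divide_le_eq)
  qed
  have fU: "f \<in> U" and f1: "inner_on V f f = 1" using f(1) by (auto simp: B_def)
  have Pff: "P f f = 0" by (simp add: P_def f1 \<mu>_def q_def)
  define g where "g = (\<lambda>x. \<mu> * f x + (- 1) * kernel_op V K f x)"
  have gU: "g \<in> U" unfolding g_def by (intro U_add U_scale U_kernel_op fU)
  have "inner_on V g h = \<mu> * inner_on V f h + (- 1) * inner_on V (kernel_op V K f) h" for h
    unfolding g_def inner_on_add_left inner_on_scale_left ..
  then have Pfg: "P f g = inner_on V g g" by (simp add: P_def)
  have expand: "P (\<lambda>x. f x + t * g x) (\<lambda>x. f x + t * g x) = 2 * t * P f g + t * t * P g g" for t
  proof -
    have s: "inner_on V (kernel_op V K g) f = inner_on V (kernel_op V K f) g"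
      by (subst kernel_op_symmetric[OF sym]) (simp_all add: inner_on_commute)
    have "P (\<lambda>x. f x + t * g x) (\<lambda>x. f x + t * g x) =
      P f f + t * P f g + t * P g f + t * t * P g g"
      unfolding P_def kernel_op_add kernel_op_scale
      by (simp add: inner_on_add_left inner_on_add_right inner_on_scale_left
          inner_on_scale_right algebra_simps)
    moreover have "P g f = P f g" unfolding P_def using s inner_on_commute[of V f g] by simp
    ultimately show ?thesis using Pff by simp
  qed
  have nn: "0 \<le> 2 * t * P f g + t * t * P g g" for t
    unfolding expand[symmetric] by (intro Pnonneg U_add U_scale fU gU)
  have "P f g = 0"
  proof (rule ccontr)
    assume "P f g \<noteq> 0"
    then have a: "0 < P f g" using Pfg inner_on_self_nonneg[of V g] by linarith
    have b: "0 \<le> P g g" by (rule Pnonneg[OF gU])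
    \<comment> \<open>Moving from \<open>f\<close> slightly in the direction \<open>-g\<close> would make the form negative.\<close>
    define t where "t = - P f g / (1 + P g g)"
    have tneg: "t < 0" using a b by (simp add: t_def divide_neg_pos)
    have "2 * P f g + t * P g g > 0"
    proof -
      have "t * P g g = - P f g * (P g g / (1 + P g g))" by (simp add: t_def)
      moreover have "P f g * (P g g / (1 + P g g)) \<le> P f g * 1"
        using a b by (intro mult_left_mono) auto
      ultimately show ?thesis using a by simp
    qed
    then have "t * (2 * P f g + t * P g g) < 0" using tneg by (simp add: mult_neg_pos)
    then show False using nn[of t] by (simp add: algebra_simps)
  qed
  then have "inner_on V g g = 0" using Pfg by simp
  then have "g x = 0" if "x \<in> V" for x using inner_on_self_eq_0[OF V] that by blast
  then have "kernel_op V K f x = \<mu> * f x" for x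
    using fU by (cases "x \<in> V") (auto simp: g_def U_def L2_def kernel_op_def)
  then have "kernel_op V K f = (\<lambda>x. \<mu> * f x)" by blast
  then show ?thesis using fU f1 by (intro exI[of _ f] exI[of _ \<mu>]) (auto simp: U_def)
qed

text \<open>An orthonormal family of \<open>card V\<close> eigenvectors \<open>e i\<close> in \<open>L\<^sup>2(V)\<close> with eigenvalues \<open>l i\<close>,
  indexed by the naturals below \<open>card V\<close>, so that the eigenvalues are listed with multiplicity.
  Completeness is a consequence (\<open>eigenbasis_expansion\<close>).\<close>

definition eigenbasis ::
  "'v set \<Rightarrow> ('v \<Rightarrow> 'v \<Rightarrow> real) \<Rightarrow> (nat \<Rightarrow> 'v \<Rightarrow> real) \<Rightarrow> (nat \<Rightarrow> real) \<Rightarrow> bool" where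
  "eigenbasis V K e l \<longleftrightarrow>
     (\<forall>i<card V. e i \<in> L2 V \<and> kernel_op V K (e i) = (\<lambda>x. l i * e i x)) \<and>
     (\<forall>i<card V. \<forall>j<card V. inner_on V (e i) (e j) = (if i = j then 1 else 0))"

theorem eigenbasis_exists:
  assumes V: "finite V" and sym: "\<forall>x\<in>V. \<forall>y\<in>V. K x y = K y x"
  shows "\<exists>e l. eigenbasis V K e l"
proof -
  have "\<exists>e l. (\<forall>i<k. e i \<in> L2 V \<and> kernel_op V K (e i) = (\<lambda>x. l i * e i x)) \<and>
     (\<forall>i<k. \<forall>j<k. inner_on V (e i) (e j) = (if i = j then 1 else 0))" if "k \<le> card V" for k
    using that
  proof (induction k)
    case (Suc k)
    then have "k \<le> card V" by simp
    from Suc.IH[OF this] obtain e l where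
      "(\<forall>i<k. e i \<in> L2 V \<and> kernel_op V K (e i) = (\<lambda>x. l i * e i x)) \<and>
       (\<forall>i<k. \<forall>j<k. inner_on V (e i) (e j) = (if i = j then 1 else 0))" by blast
    then have el: "\<And>i. i < k \<Longrightarrow> e i \<in> L2 V"
      "\<And>i. i < k \<Longrightarrow> kernel_op V K (e i) = (\<lambda>x. l i * e i x)"
      "\<And>i j. i < k \<Longrightarrow> j < k \<Longrightarrow> inner_on V (e i) (e j) = (if i = j then 1 else 0)"
      by blast+
    obtain f \<mu> where f: "f \<in> L2 V" "inner_on V f f = 1" "\<And>i. i < k \<Longrightarrow> inner_on V f (e i) = 0"
      "kernel_op V K f = (\<lambda>x. \<mu> * f x)"
      using eigenvector_in_orthogonal_complement[OF V sym, where k=k and e=e and l=l] el(2) Suc.prems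
      by (auto simp: Suc_le_eq)
    have f': "inner_on V (e i) f = 0" if "i < k" for i
      using f(3)[OF that] by (subst inner_on_commute)
    show ?case
      by (rule exI[of _ "e(k := f)"], rule exI[of _ "l(k := \<mu>)"])
        (use el f f' in \<open>auto simp: less_Suc_eq\<close>)
  qed auto
  from this[of "card V"] show ?thesis unfolding eigenbasis_def by auto
qed

lemma eigenbasisD:
  assumes "eigenbasis V K e l" "i < card V"
  shows "e i \<in> L2 V" "kernel_op V K (e i) = (\<lambda>x. l i * e i x)" "inner_on V (e i) (e i) = 1"
    "\<And>j. j < card V \<Longrightarrow> inner_on V (e i) (e j) = (if i = j then 1 else 0)"
  using assms by (auto simp: eigenbasis_def)

lemma eigenbasis_inner_on_sum:
  assumes E: "eigenbasis V K e l" and I: "I \<subseteq> {..<card V}" and j: "j < card V"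
  shows "inner_on V (\<lambda>x. \<Sum>i\<in>I. c i * e i x) (e j) = (if j \<in> I then c j else 0)"
proof -
  have fin: "finite I" using I finite_subset by blast
  have "inner_on V (\<lambda>x. \<Sum>i\<in>I. c i * e i x) (e j) = (\<Sum>i\<in>I. c i * inner_on V (e i) (e j))"
    by (rule inner_on_sum_left)
  also have "\<dots> = (\<Sum>i\<in>I. if i = j then c i else 0)"
    using I j eigenbasisD(4)[OF E] by (intro sum.cong refl) auto
  finally show ?thesis using fin by simp
qed

lemma eigenbasis_expansion:
  assumes V: "finite V" and E: "eigenbasis V K e l" and f: "f \<in> L2 V"
  shows "f x = (\<Sum>i<card V. inner_on V f (e i) * e i x)"
proof (rule ccontr)
  define n where "n = card V"
  \<comment> \<open>If the remainder \<open>r\<close> were nonzero, there would be one independent vector too many.\<close>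
  define r where "r = (\<lambda>x. f x + (- 1) * (\<Sum>i<n. inner_on V f (e i) * e i x))"
  assume "f x \<noteq> (\<Sum>i<card V. inner_on V f (e i) * e i x)"
  then have rx: "r x \<noteq> 0" by (simp add: r_def n_def)
  have rL2: "r \<in> L2 V"
    using f eigenbasisD(1)[OF E] by (auto simp: r_def L2_def n_def)
  then have x: "x \<in> V" using rx by (auto simp: L2_def)
  have r_orth: "inner_on V r (e j) = 0" if "j < n" for j
    unfolding r_def inner_on_add_left inner_on_scale_left
    using eigenbasis_inner_on_sum[OF E, of "{..<n}" j "\<lambda>i. inner_on V f (e i)"] that by (simp add: n_def)
  have "card V < card {..n}" by (simp add: n_def)
  from homogeneous_system[OF V _ this, of "\<lambda>x i. if i < n then e i x else r x"] obtain c where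
    c: "\<exists>i\<le>n. c i \<noteq> 0" "\<forall>x\<in>V. (\<Sum>i\<le>n. (if i < n then e i x else r x) * c i) = 0"
    by auto
  have split: "(\<Sum>i<n. c i * e i x) + c n * r x = 0" if "x \<in> V" for x
    using bspec[OF c(2) that]
    by (simp add: lessThan_Suc_atMost[symmetric] lessThan_Suc mult.commute add.commute)
  have cj: "c j = 0" if "j < n" for j
  proof -
    have "inner_on V (\<lambda>x. (\<Sum>i<n. c i * e i x) + c n * r x) (e j) = 0"
      using split by (simp add: inner_on_def)
    then show ?thesis
      unfolding inner_on_add_left inner_on_scale_left r_orth[OF that]
      using eigenbasis_inner_on_sum[OF E, of "{..<n}" j c] that by (simp add: n_def)
  qed
  then have "c n * r x = 0" using split[OF x] by simp
  then have "c n = 0" using rx by simp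
  then show False using c(1) cj by (metis nat_less_le)
qed

lemma eigenbasis_form:
  assumes V: "finite V" and E: "eigenbasis V K e l" and f: "f \<in> L2 V"
  shows "inner_on V (kernel_op V K f) f = (\<Sum>i<card V. l i * (inner_on V f (e i))\<^sup>2)"
    and "inner_on V f f = (\<Sum>i<card V. (inner_on V f (e i))\<^sup>2)"
proof -
  have f_eq: "f = (\<lambda>x. \<Sum>i<card V. inner_on V f (e i) * e i x)"
    using eigenbasis_expansion[OF V E f] by blast
  have "kernel_op V K f = (\<lambda>x. \<Sum>i<card V. inner_on V f (e i) * kernel_op V K (e i) x)"
    by (subst f_eq) (rule kernel_op_sum)
  then have "inner_on V (kernel_op V K f) f =
      (\<Sum>i<card V. inner_on V f (e i) * inner_on V (kernel_op V K (e i)) f)"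
    by (simp only: inner_on_sum_left)
  also have "\<dots> = (\<Sum>i<card V. l i * (inner_on V f (e i))\<^sup>2)"
    by (intro sum.cong refl)
      (simp add: eigenbasisD(2)[OF E] inner_on_scale_left inner_on_commute[of V _ f] power2_eq_square)
  finally show "inner_on V (kernel_op V K f) f = (\<Sum>i<card V. l i * (inner_on V f (e i))\<^sup>2)" .
  have "inner_on V f f = inner_on V (\<lambda>x. \<Sum>i<card V. inner_on V f (e i) * e i x) f"
    using f_eq by simp
  also have "\<dots> = (\<Sum>i<card V. (inner_on V f (e i))\<^sup>2)"
    by (simp only: inner_on_sum_left) (simp add: inner_on_commute[of V _ f] power2_eq_square)
  finally show "inner_on V f f = (\<Sum>i<card V. (inner_on V f (e i))\<^sup>2)" .
qed

section \<open>Eigenvalue counts and traces\<close>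

text \<open>If two kernels agree off a set \<open>D\<close>, then, by symmetry of the hypotheses, their numbers of
  eigenvalues at most \<open>t\<close> differ by at most \<open>card D\<close>. Otherwise there would be a nonzero \<open>f\<close>
  vanishing on \<open>D\<close>, spanned by eigenvectors of \<open>K\<close> for eigenvalues at most \<open>t\<close>, and orthogonal to
  all eigenvectors of \<open>K'\<close> for eigenvalues at most \<open>t\<close>. On it the two quadratic forms agree, but
  that of \<open>K\<close> is at most \<open>t \<langle>f, f\<rangle>\<close> and that of \<open>K'\<close> is larger.\<close>

lemma eigenvalue_count_perturbation:
  assumes V: "finite V" and D: "D \<subseteq> V"
    and E: "eigenbasis V K e l" and E': "eigenbasis V K' e' l'"
    and agree: "\<And>x y. x \<in> V - D \<Longrightarrow> y \<in> V - D \<Longrightarrow> K x y = K' x y"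
  shows "card {i. i < card V \<and> l i \<le> t} \<le> card {i. i < card V \<and> l' i \<le> t} + card D"
proof (rule ccontr)
  define n where "n = card V"
  define I where "I = {i. i < n \<and> l i \<le> t}"
  define I' where "I' = {i. i < n \<and> l' i \<le> t}"
  have finD: "finite D" using D V finite_subset by blast
  assume "\<not> ?thesis"
  then have less: "card (I' <+> D) < card I"
    using finD by (simp add: I_def I'_def n_def card_Plus)
  define a where "a j i = (case j of Inl j \<Rightarrow> inner_on V (e i) (e' j) | Inr x \<Rightarrow> e i x)" for j i
  have "finite (I' <+> D)" "finite I" using finD by (auto simp: I_def I'_def)
  from homogeneous_system[OF this less, of a] obtain c where
    c: "\<exists>i\<in>I. c i \<noteq> 0" "\<forall>j\<in>I' <+> D. (\<Sum>i\<in>I. a j i * c i) = 0" by blast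
  define f where "f = (\<lambda>x. \<Sum>i\<in>I. c i * e i x)"
  have I_sub: "I \<subseteq> {..<card V}" by (auto simp: I_def n_def)
  have fL2: "f \<in> L2 V"
    using eigenbasisD(1)[OF E] by (auto simp: f_def L2_def I_def n_def)
  have coef: "inner_on V f (e i) = (if i \<in> I then c i else 0)" if "i < n" for i
    unfolding f_def using eigenbasis_inner_on_sum[OF E I_sub] that by (simp add: n_def)
  have f_D: "f x = 0" if "x \<in> D" for x
    using bspec[OF c(2), of "Inr x"] that by (simp add: a_def f_def mult.commute InrI)
  have coef': "inner_on V f (e' j) = 0" if "j \<in> I'" for j
    using bspec[OF c(2), of "Inl j"] that
    by (simp add: a_def f_def inner_on_sum_left mult.commute InlI)
  obtain i0 where i0: "i0 \<in> I" "c i0 \<noteq> 0" using c(1) by blast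
  then have i0n: "i0 < n" by (simp add: I_def)
  have pos: "0 < inner_on V f f"
    unfolding eigenbasis_form(2)[OF V E fL2]
    by (rule sum_pos2[of _ i0]) (use i0 i0n coef in \<open>auto simp: n_def\<close>)
  have upper: "inner_on V (kernel_op V K f) f \<le> t * inner_on V f f"
    unfolding eigenbasis_form[OF V E fL2] sum_distrib_left
  proof (intro sum_mono)
    fix i assume "i \<in> {..<card V}"
    then have "i < n" by (simp add: n_def)
    then show "l i * (inner_on V f (e i))\<^sup>2 \<le> t * (inner_on V f (e i))\<^sup>2"
      using coef by (cases "i \<in> I") (auto simp: I_def intro: mult_right_mono)
  qed
  have "\<exists>j<n. inner_on V f (e' j) \<noteq> 0"
  proof (rule ccontr)
    assume "\<not> ?thesis"
    then have "inner_on V f f = 0"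
      unfolding eigenbasis_form(2)[OF V E' fL2] by (simp add: n_def)
    then show False using pos by simp
  qed
  then obtain j0 where j0: "j0 < n" "inner_on V f (e' j0) \<noteq> 0" by blast
  have lower: "t * inner_on V f f < inner_on V (kernel_op V K' f) f"
    unfolding eigenbasis_form[OF V E' fL2] sum_distrib_left
  proof (rule sum_strict_mono_ex1)
    show "\<forall>j\<in>{..<card V}. t * (inner_on V f (e' j))\<^sup>2 \<le> l' j * (inner_on V f (e' j))\<^sup>2"
    proof
      fix j assume "j \<in> {..<card V}"
      then have "j < n" by (simp add: n_def)
      then show "t * (inner_on V f (e' j))\<^sup>2 \<le> l' j * (inner_on V f (e' j))\<^sup>2"
        using coef'[of j] by (cases "j \<in> I'") (auto simp: I'_def intro: mult_right_mono)
    qed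
    have "j0 \<notin> I'" using coef' j0 by blast
    then have "t < l' j0" using j0 by (auto simp: I'_def)
    then show "\<exists>j\<in>{..<card V}. t * (inner_on V f (e' j))\<^sup>2 < l' j * (inner_on V f (e' j))\<^sup>2"
      using j0 by (intro bexI[of _ j0]) (auto simp: n_def)
  qed simp
  have "kernel_op V K f x * f x = kernel_op V K' f x * f x" if "x \<in> V" for x
  proof (cases "x \<in> D")
    case False
    have "(\<Sum>y\<in>V. K x y * f y) = (\<Sum>y\<in>V. K' x y * f y)"
      using agree[of x] False that f_D by (intro sum.cong) auto
    then show ?thesis by (simp add: kernel_op_def)
  qed (simp add: f_D)
  then have "inner_on V (kernel_op V K f) f = inner_on V (kernel_op V K' f) f"
    unfolding inner_on_def by (intro sum.cong) auto
  then show False using upper lower by linarith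
qed

text \<open>The kernel of the \<open>k\<close>-th power of the operator with kernel \<open>K\<close> on \<open>V\<close>.\<close>

fun kernel_pow :: "'v set \<Rightarrow> ('v \<Rightarrow> 'v \<Rightarrow> real) \<Rightarrow> nat \<Rightarrow> 'v \<Rightarrow> 'v \<Rightarrow> real" where
  "kernel_pow V K 0 x y = (if x = y then 1 else 0)"
| "kernel_pow V K (Suc k) x y = (\<Sum>z\<in>V. K x z * kernel_pow V K k z y)"

lemma kernel_pow_eigenbasis:
  assumes V: "finite V" and E: "eigenbasis V K e l" and "x \<in> V" "y \<in> V"
  shows "kernel_pow V K k x y = (\<Sum>i<card V. l i ^ k * (e i x * e i y))"
  using \<open>x \<in> V\<close>
proof (induction k arbitrary: x)
  case 0
  define \<delta> where "\<delta> = (\<lambda>x. if x = y then 1 else 0 :: real)"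
  have "\<delta> \<in> L2 V" using \<open>y \<in> V\<close> by (auto simp: \<delta>_def L2_def)
  have "inner_on V \<delta> (e i) = e i y" for i
    using \<open>y \<in> V\<close> V by (simp add: \<delta>_def inner_on_def if_distrib[of "\<lambda>u. u * _"] cong: if_cong)
  then show ?case using eigenbasis_expansion[OF V E \<open>\<delta> \<in> L2 V\<close>, of x]
    by (simp add: \<delta>_def mult.commute)
next
  case (Suc k)
  have "kernel_pow V K (Suc k) x y = (\<Sum>z\<in>V. \<Sum>i<card V. l i ^ k * e i y * (K x z * e i z))"
    by (simp add: Suc.IH sum_distrib_left mult_ac)
  also have "\<dots> = (\<Sum>i<card V. \<Sum>z\<in>V. l i ^ k * e i y * (K x z * e i z))" by (rule sum.swap)
  also have "\<dots> = (\<Sum>i<card V. l i ^ k * e i y * kernel_op V K (e i) x)"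
    using Suc.prems by (simp add: kernel_op_def sum_distrib_left)
  also have "\<dots> = (\<Sum>i<card V. l i ^ Suc k * (e i x * e i y))"
    by (intro sum.cong refl) (simp add: eigenbasisD(2)[OF E])
  finally show ?case .
qed

lemma trace_eigenbasis:
  assumes V: "finite V" and E: "eigenbasis V K e l"
  shows "(\<Sum>i<card V. l i ^ k) = (\<Sum>x\<in>V. kernel_pow V K k x x)"
proof -
  have "(\<Sum>x\<in>V. kernel_pow V K k x x) = (\<Sum>x\<in>V. \<Sum>i<card V. l i ^ k * (e i x * e i x))"
    by (simp add: kernel_pow_eigenbasis[OF V E])
  also have "\<dots> = (\<Sum>i<card V. l i ^ k * inner_on V (e i) (e i))"
    by (subst sum.swap) (simp add: inner_on_def sum_distrib_left)
  also have "\<dots> = (\<Sum>i<card V. l i ^ k)"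
    using eigenbasisD(3)[OF E] by simp
  finally show ?thesis by simp
qed

lemma eigenbasis_nonzero:
  assumes "eigenbasis V K e l" "i < card V"
  shows "\<exists>x\<in>V. e i x \<noteq> 0"
proof (rule ccontr)
  assume "\<not> ?thesis"
  then have "inner_on V (e i) (e i) = 0" by (simp add: inner_on_def)
  then show False using eigenbasisD(3)[OF assms] by simp
qed

text \<open>The bound follows from evaluating the eigenvalue equation at a point where the eigenvector is
  largest in absolute value.\<close>

lemma eigenvalue_bound:
  assumes V: "finite V" and E: "eigenbasis V K e l" and i: "i < card V"
    and row: "\<And>x. x \<in> V \<Longrightarrow> (\<Sum>y\<in>V. \<bar>K x y\<bar>) \<le> M"
  shows "\<bar>l i\<bar> \<le> M"
proof -
  have "V \<noteq> {}" using i by auto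
  define m where "m = Max ((\<lambda>x. \<bar>e i x\<bar>) ` V)"
  have le_m: "\<bar>e i x\<bar> \<le> m" if "x \<in> V" for x using that V by (simp add: m_def)
  have "m \<in> (\<lambda>x. \<bar>e i x\<bar>) ` V" unfolding m_def using V \<open>V \<noteq> {}\<close> by (intro Max_in) auto
  then obtain x where x: "x \<in> V" "\<bar>e i x\<bar> = m" by auto
  have "0 < m" using eigenbasis_nonzero[OF E i] le_m by force
  have "\<bar>l i\<bar> * m = \<bar>kernel_op V K (e i) x\<bar>"
    using eigenbasisD(2)[OF E i] x by (simp add: abs_mult)
  also have "\<dots> \<le> (\<Sum>y\<in>V. \<bar>K x y\<bar> * m)"
    using x le_m unfolding kernel_op_def
    by (auto intro!: order_trans[OF sum_abs] sum_mono mult_left_mono simp: abs_mult)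
  also have "\<dots> \<le> M * m"
    using row[OF x(1)] \<open>0 < m\<close> by (simp add: sum_distrib_right[symmetric])
  finally show ?thesis using \<open>0 < m\<close> by simp
qed

lemma eigenvalue_in_spectrum:
  assumes V: "finite V" and E: "eigenbasis V K e l"
    and sym: "\<forall>x\<in>V. \<forall>y\<in>V. K x y = K y x"
    and f: "f \<in> L2 V" "kernel_op V K f = (\<lambda>x. \<mu> * f x)" and i: "i < card V" and "\<mu> \<noteq> l i"
  shows "inner_on V f (e i) = 0"
proof -
  have "\<mu> * inner_on V f (e i) = inner_on V (kernel_op V K f) (e i)" by (simp add: f inner_on_scale_left)
  also have "\<dots> = inner_on V f (kernel_op V K (e i))" by (rule kernel_op_symmetric[OF sym])
  also have "\<dots> = l i * inner_on V f (e i)" by (simp add: eigenbasisD(2)[OF E i] inner_on_scale_right)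
  finally show ?thesis using \<open>\<mu> \<noteq> l i\<close> by simp
qed

lemma finite_volume_eq_kernel_op: "finite_volume A H = kernel_op (verts H) A"
  by (simp add: finite_volume_def kernel_op_def fun_eq_iff)

lemma eigenspace_eq_span:
  assumes V: "finite V" and E: "eigenbasis V K e l"
    and sym: "\<forall>x\<in>V. \<forall>y\<in>V. K x y = K y x"
  shows "eigenspace V (kernel_op V K) \<mu> = fun_space.span (e ` {i. i < card V \<and> l i = \<mu>})"
proof
  let ?I = "{i. i < card V \<and> l i = \<mu>}"
  show "fun_space.span (e ` ?I) \<subseteq> eigenspace V (kernel_op V K) \<mu>"
  proof (rule fun_space.span_minimal)
    show "e ` ?I \<subseteq> eigenspace V (kernel_op V K) \<mu>"
      using eigenbasisD[OF E] by (auto simp: eigenspace_def fun_scale_def)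
    show "fun_space.subspace (eigenspace V (kernel_op V K) \<mu>)"
      by (rule fun_space.subspaceI)
        (auto simp: eigenspace_def L2_def fun_scale_def plus_fun_def kernel_op_add kernel_op_scale
          fun_eq_iff algebra_simps, auto simp: kernel_op_def)
  qed
  show "eigenspace V (kernel_op V K) \<mu> \<subseteq> fun_space.span (e ` ?I)"
  proof
    fix f assume "f \<in> eigenspace V (kernel_op V K) \<mu>"
    then have f: "f \<in> L2 V" "kernel_op V K f = (\<lambda>x. \<mu> * f x)"
      by (auto simp: eigenspace_def fun_scale_def)
    have zero: "inner_on V f (e i) = 0" if "i < card V" "i \<notin> ?I" for i
      using eigenvalue_in_spectrum[OF V E sym f, of i] that by auto
    have "f x = (\<Sum>i\<in>?I. inner_on V f (e i) * e i x)" for x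
      unfolding eigenbasis_expansion[OF V E f(1), of x]
      by (rule sum.mono_neutral_right) (use zero in auto)
    also have "\<dots> x = (\<Sum>i\<in>?I. fun_scale (inner_on V f (e i)) (e i)) x" for x
    proof -
      have "(\<Sum>i\<in>J. g i) x = (\<Sum>i\<in>J. g i x)" if "finite J" for J and g :: "nat \<Rightarrow> 'a \<Rightarrow> real"
        using that by (induction J rule: finite_induct) auto
      then show ?thesis by (simp add: fun_scale_def)
    qed
    finally have "f = (\<Sum>i\<in>?I. fun_scale (inner_on V f (e i)) (e i))" by blast
    also have "\<dots> \<in> fun_space.span (e ` ?I)"
      by (intro fun_space.span_sum fun_space.span_scale fun_space.span_base) auto
    finally show "f \<in> fun_space.span (e ` ?I)" .
  qed
qed

lemma eigenbasis_inj:
  assumes "eigenbasis V K e l"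
  shows "inj_on e {..<card V}"
proof (rule inj_onI)
  fix i j assume ij: "i \<in> {..<card V}" "j \<in> {..<card V}" "e i = e j"
  then have "inner_on V (e i) (e j) = 1" using eigenbasisD(3)[OF assms] by simp
  then show "i = j" using eigenbasisD(4)[OF assms, of i j] ij by (auto split: if_splits)
qed

lemma eigenbasis_independent:
  assumes E: "eigenbasis V K e l" and I: "I \<subseteq> {..<card V}"
  shows "fun_space.independent (e ` I)"
proof -
  have fin: "finite I" using I finite_subset by blast
  have inj: "inj_on e I" using eigenbasis_inj[OF E] I inj_on_subset by blast
  have "u (e j) = 0" if sum0: "(\<Sum>v\<in>e ` I. fun_scale (u v) v) = 0" and j: "j \<in> I" for u j
  proof -
    have app: "(\<Sum>i\<in>J. g i) x = (\<Sum>i\<in>J. g i x)" if "finite J"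
      for J and g :: "nat \<Rightarrow> 'a \<Rightarrow> real" and x
      using that by (induction J rule: finite_induct) auto
    have "(\<Sum>i\<in>I. fun_scale (u (e i)) (e i)) = 0"
      using sum0 by (simp add: sum.reindex[OF inj])
    then have "(\<Sum>i\<in>I. u (e i) * e i x) = 0" for x
      using app[OF fin, of "\<lambda>i. fun_scale (u (e i)) (e i)" x] by (simp add: fun_scale_def)
    then have "inner_on V (\<lambda>x. \<Sum>i\<in>I. u (e i) * e i x) (e j) = 0" by (simp add: inner_on_def)
    then show ?thesis using eigenbasis_inner_on_sum[OF E I, of j "\<lambda>i. u (e i)"] j I by auto
  qed
  then show ?thesis using fin by (subst fun_space.dependent_finite) auto
qed

lemma dim_eigenspace:
  assumes V: "finite V" and E: "eigenbasis V K e l"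
    and sym: "\<forall>x\<in>V. \<forall>y\<in>V. K x y = K y x"
  shows "fun_space.dim (eigenspace V (kernel_op V K) \<mu>) = card {i. i < card V \<and> l i = \<mu>}"
proof -
  let ?I = "{i. i < card V \<and> l i = \<mu>}"
  have sub: "?I \<subseteq> {..<card V}" by auto
  have "fun_space.dim (fun_space.span (e ` ?I)) = card (e ` ?I)"
    by (rule fun_space.dim_span_eq_card_independent[OF eigenbasis_independent[OF E sub]])
  also have "\<dots> = card ?I"
    by (rule card_image) (rule inj_on_subset[OF eigenbasis_inj[OF E] sub])
  finally show ?thesis by (simp add: eigenspace_eq_span[OF V E sym])
qed

lemma eigenvalues_eq:
  assumes V: "finite V" and E: "eigenbasis V K e l"
    and sym: "\<forall>x\<in>V. \<forall>y\<in>V. K x y = K y x"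
  shows "eigenvalues V (kernel_op V K) = l ` {..<card V}"
proof
  show "l ` {..<card V} \<subseteq> eigenvalues V (kernel_op V K)"
  proof
    fix \<mu> assume "\<mu> \<in> l ` {..<card V}"
    then obtain i where i: "i < card V" "\<mu> = l i" by auto
    have "e i \<in> eigenspace V (kernel_op V K) \<mu>"
      using eigenbasisD(1,2)[OF E i(1)] i by (simp add: eigenspace_def fun_scale_def)
    moreover have "e i \<noteq> 0" using eigenbasis_nonzero[OF E i(1)] by auto
    ultimately show "\<mu> \<in> eigenvalues V (kernel_op V K)" by (auto simp: eigenvalues_def)
  qed
  show "eigenvalues V (kernel_op V K) \<subseteq> l ` {..<card V}"
  proof
    fix \<mu> assume "\<mu> \<in> eigenvalues V (kernel_op V K)"
    then obtain f where f: "f \<in> eigenspace V (kernel_op V K) \<mu>" "f \<noteq> 0" by (auto simp: eigenvalues_def)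
    have "{i. i < card V \<and> l i = \<mu>} \<noteq> {}"
    proof
      assume "{i. i < card V \<and> l i = \<mu>} = {}"
      then show False
        using f unfolding eigenspace_eq_span[OF V E sym] \<open>_ = {}\<close> by simp
    qed
    then show "\<mu> \<in> l ` {..<card V}" by auto
  qed
qed

text \<open>The proportion of the numbers \<open>l 0, \<dots>, l (n - 1)\<close> that are at most \<open>t\<close>.\<close>

definition ecdf :: "nat \<Rightarrow> (nat \<Rightarrow> real) \<Rightarrow> real \<Rightarrow> real" where
  "ecdf n l t = real (card {i. i < n \<and> l i \<le> t}) / real n"

theorem spectral_distribution_eq:
  assumes V: "finite V" and E: "eigenbasis V K e l"
    and sym: "\<forall>x\<in>V. \<forall>y\<in>V. K x y = K y x"
  shows "spectral_distribution V (kernel_op V K) = ecdf (card V) l"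
proof
  fix t
  let ?T = "{\<mu> \<in> l ` {..<card V}. \<mu> \<le> t}" and ?S = "{i. i < card V \<and> l i \<le> t}"
  have "(\<Sum>\<mu>\<in>?T. card {i. i < card V \<and> l i = \<mu>}) = (\<Sum>\<mu>\<in>?T. \<Sum>i\<in>{i \<in> ?S. l i = \<mu>}. 1)"
    by (intro sum.cong refl) (auto intro!: arg_cong[of _ _ card])
  also have "\<dots> = (\<Sum>i\<in>?S. 1)" by (rule sum.group) auto
  finally show "spectral_distribution V (kernel_op V K) t = ecdf (card V) l t"
    by (simp add: spectral_distribution_def ecdf_def eigenvalues_eq[OF V E sym]
        dim_eigenspace[OF V E sym])
qed

section \<open>Spectra of block-diagonal kernels with small blocks\<close>

lemma kernel_op_kernel_cong:
  "(\<And>x y. x \<in> V \<Longrightarrow> y \<in> V \<Longrightarrow> K x y = K' x y) \<Longrightarrow> kernel_op V K = kernel_op V K'"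
  by (auto simp: kernel_op_def fun_eq_iff intro!: sum.cong)

lemma eigenvaluesI:
  assumes "x \<in> V" "f x \<noteq> 0" and eq: "\<And>x. x \<in> V \<Longrightarrow> (\<Sum>y\<in>V. K x y * f y) = \<mu> * f x"
  shows "\<mu> \<in> eigenvalues V (kernel_op V K)"
proof -
  define g where "g = (\<lambda>x. if x \<in> V then f x else 0)"
  have "(\<Sum>y\<in>V. K x y * g y) = (\<Sum>y\<in>V. K x y * f y)" for x
    by (intro sum.cong) (auto simp: g_def)
  then have "g \<in> eigenspace V (kernel_op V K) \<mu>"
    using eq by (auto simp: eigenspace_def L2_def kernel_op_def fun_scale_def fun_eq_iff g_def)
  moreover have "g \<noteq> 0" using assms(1,2) by (auto simp: g_def fun_eq_iff)
  ultimately show ?thesis by (auto simp: eigenvalues_def)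
qed

lemma eigenvaluesE:
  assumes "\<mu> \<in> eigenvalues V (kernel_op V K)"
  obtains f x where "x \<in> V" "f x \<noteq> 0" "\<And>x. x \<in> V \<Longrightarrow> (\<Sum>y\<in>V. K x y * f y) = \<mu> * f x"
proof -
  obtain f where f: "f \<in> L2 V" "kernel_op V K f = (\<lambda>x. \<mu> * f x)" "f \<noteq> 0"
    using assms by (auto simp: eigenvalues_def eigenspace_def fun_scale_def)
  obtain x where "f x \<noteq> 0" using f(3) by (auto simp: fun_eq_iff)
  then have "x \<in> V" using f(1) by (auto simp: L2_def)
  moreover have "(\<Sum>y\<in>V. K x y * f y) = \<mu> * f x" if "x \<in> V" for x
    using fun_cong[OF f(2), of x] that by (simp add: kernel_op_def)
  ultimately show ?thesis using \<open>f x \<noteq> 0\<close> that by blast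
qed

lemma finite_eigenvalues:
  assumes "finite V" "\<forall>x\<in>V. \<forall>y\<in>V. K x y = K y x"
  shows "finite (eigenvalues V (kernel_op V K))"
  using eigenbasis_exists[OF assms] eigenvalues_eq[OF assms(1) _ assms(2)] by auto

lemma eigenvalues_reindex:
  assumes h: "bij_betw h U V"
  shows "eigenvalues V (kernel_op V K) \<subseteq> eigenvalues U (kernel_op U (\<lambda>i j. K (h i) (h j)))"
proof
  fix \<mu> assume "\<mu> \<in> eigenvalues V (kernel_op V K)"
  then obtain f x where f: "x \<in> V" "f x \<noteq> 0"
    "\<And>x. x \<in> V \<Longrightarrow> (\<Sum>y\<in>V. K x y * f y) = \<mu> * f x" by (rule eigenvaluesE) blast
  obtain i where i: "i \<in> U" "h i = x" using h f(1) by (metis bij_betw_imp_surj_on imageE)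
  show "\<mu> \<in> eigenvalues U (kernel_op U (\<lambda>i j. K (h i) (h j)))"
  proof (rule eigenvaluesI[of i _ "\<lambda>i. f (h i)"])
    fix j assume "j \<in> U"
    then have "h j \<in> V" using h by (auto simp: bij_betw_def)
    then show "(\<Sum>k\<in>U. K (h j) (h k) * f (h k)) = \<mu> * f (h j)"
      using f(3) sum.reindex_bij_betw[OF h, of "\<lambda>y. K (h j) y * f y"] by simp
  qed (use i f in auto)
qed

text \<open>All eigenvalues of symmetric matrices of size at most \<open>K\<close> with entries in \<open>Vals\<close>. A matrix of
  size \<open>k\<close> is an extensional function on \<open>{..<k} \<times> {..<k}\<close>, so that there are finitely many.\<close>

definition small_spectra :: "real set \<Rightarrow> nat \<Rightarrow> real set" where
  "small_spectra Vals K = (\<Union>k\<in>{..K}.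
     \<Union>M\<in>{M \<in> {..<k} \<times> {..<k} \<rightarrow>\<^sub>E Vals. \<forall>i<k. \<forall>j<k. M (i, j) = M (j, i)}.
       eigenvalues {..<k} (kernel_op {..<k} (\<lambda>i j. M (i, j))))"

lemma finite_small_spectra: "finite Vals \<Longrightarrow> finite (small_spectra Vals K)"
  unfolding small_spectra_def
  by (intro finite_UN_I finite_eigenvalues finite_subset[OF Collect_restrict finite_PiE]) auto

lemma eigenvalues_subset_small_spectra:
  assumes V: "finite V" "card V \<le> n" and sym: "\<forall>x\<in>V. \<forall>y\<in>V. K x y = K y x"
    and Vals: "\<And>x y. x \<in> V \<Longrightarrow> y \<in> V \<Longrightarrow> K x y \<in> Vals"
  shows "eigenvalues V (kernel_op V K) \<subseteq> small_spectra Vals n"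
proof -
  obtain h where h: "bij_betw h {..<card V} V"
    using ex_bij_betw_nat_finite[OF V(1)] by (auto simp: atLeast0LessThan)
  then have hV: "h i \<in> V" if "i < card V" for i using that by (auto simp: bij_betw_def)
  let ?U = "{..<card V}"
  define M where "M = restrict (\<lambda>(i, j). K (h i) (h j)) (?U \<times> ?U)"
  have "M \<in> ?U \<times> ?U \<rightarrow>\<^sub>E Vals" using Vals hV by (auto simp: M_def)
  moreover have "\<forall>i<card V. \<forall>j<card V. M (i, j) = M (j, i)" using sym hV by (auto simp: M_def)
  moreover have "kernel_op ?U (\<lambda>i j. K (h i) (h j)) = kernel_op ?U (\<lambda>i j. M (i, j))"
    by (rule kernel_op_kernel_cong) (auto simp: M_def)
  ultimately have "eigenvalues ?U (kernel_op ?U (\<lambda>i j. K (h i) (h j))) \<subseteq> small_spectra Vals n"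
    unfolding small_spectra_def using V(2)
    by (intro order_trans[OF _ UN_upper[of "card V"]] order_trans[OF _ UN_upper[of M]]) auto
  then show ?thesis using eigenvalues_reindex[OF h] by blast
qed

text \<open>A kernel that vanishes between different classes of an equivalence relation has only eigenvalues
  of its blocks.\<close>

lemma block_eigenvalue:
  assumes R: "equiv UNIV R" and fin: "finite W"
    and \<mu>: "\<mu> \<in> eigenvalues W (kernel_op W (\<lambda>x y. if (x, y) \<in> R then K x y else 0))"
  shows "\<exists>x\<in>W. \<mu> \<in> eigenvalues (W \<inter> R `` {x}) (kernel_op (W \<inter> R `` {x}) K)"
proof -
  from \<mu> obtain f x where x: "x \<in> W" "f x \<noteq> 0" and
    f: "\<And>x. x \<in> W \<Longrightarrow> (\<Sum>y\<in>W. (if (x, y) \<in> R then K x y else 0) * f y) = \<mu> * f x"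
    by (rule eigenvaluesE) blast
  have "\<mu> \<in> eigenvalues (W \<inter> R `` {x}) (kernel_op (W \<inter> R `` {x}) K)"
  proof (rule eigenvaluesI[of x _ f])
    show "x \<in> W \<inter> R `` {x}" using x R by (auto simp: equiv_def refl_on_def)
    fix y assume y: "y \<in> W \<inter> R `` {x}"
    have "R `` {y} = R `` {x}" using y equiv_class_eq[OF R] by blast
    then have eq: "(y, z) \<in> R \<longleftrightarrow> z \<in> R `` {x}" for z by blast
    have "(\<Sum>z\<in>W \<inter> R `` {x}. K y z * f z) =
        (\<Sum>z\<in>W \<inter> R `` {x}. (if (y, z) \<in> R then K y z else 0) * f z)"
      by (intro sum.cong) (auto simp: eq)
    also have "\<dots> = (\<Sum>z\<in>W. (if (y, z) \<in> R then K y z else 0) * f z)"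
      by (rule sum.mono_neutral_left) (use fin eq in auto)
    finally show "(\<Sum>z\<in>W \<inter> R `` {x}. K y z * f z) = \<mu> * f y" using f y by simp
  qed (use x in auto)
  then show ?thesis using x by blast
qed

section \<open>Uniform convergence of distribution functions\<close>

lemma ecdf_mono: "t \<le> u \<Longrightarrow> ecdf n l t \<le> ecdf n l u"
  unfolding ecdf_def by (intro divide_right_mono) (auto intro!: card_mono)

lemma ecdf_right_constant: "\<exists>\<delta>>0. \<forall>u. t \<le> u \<and> u < t + \<delta> \<longrightarrow> ecdf n l u = ecdf n l t"
proof -
  define \<delta> where "\<delta> = Min (insert 1 ((\<lambda>i. l i - t) ` {i. i < n \<and> t < l i}))"
  have pos: "0 < \<delta>" by (auto simp: \<delta>_def)
  have eq: "{i. i < n \<and> l i \<le> u} = {i. i < n \<and> l i \<le> t}" if "t \<le> u" "u < t + \<delta>" for u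
  proof -
    have "t + \<delta> \<le> l i" if "i < n" "t < l i" for i
    proof -
      have "\<delta> \<le> l i - t" unfolding \<delta>_def by (rule Min_le) (use that in auto)
      then show ?thesis by simp
    qed
    then show ?thesis using that by force
  qed
  have "ecdf n l u = ecdf n l t" if "t \<le> u \<and> u < t + \<delta>" for u
    unfolding ecdf_def using eq[of u] that by presburger
  then show ?thesis using pos by blast
qed

lemma uniform_limit_ecdf:
  assumes lim: "uniform_limit UNIV (\<lambda>j. ecdf (m j) (l j)) \<sigma> sequentially"
  shows "mono \<sigma>" and "continuous (at_right t) \<sigma>"
proof -
  have ptw: "(\<lambda>j. ecdf (m j) (l j) t) \<longlonglongrightarrow> \<sigma> t" for t
    using tendsto_uniform_limitI[OF lim] by simp
  show "mono \<sigma>"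
    by (intro monoI LIMSEQ_le[OF ptw ptw]) (auto intro!: ecdf_mono)
  show "continuous (at_right t) \<sigma>"
    unfolding continuous_within
  proof (rule tendstoI)
    fix \<epsilon> :: real assume "0 < \<epsilon>"
    then have "\<forall>\<^sub>F j in sequentially. \<forall>x\<in>UNIV. dist (ecdf (m j) (l j) x) (\<sigma> x) < \<epsilon> / 2"
      by (intro uniform_limitD[OF lim]) simp
    then obtain j where j: "\<And>x. dist (ecdf (m j) (l j) x) (\<sigma> x) < \<epsilon> / 2"
      by (auto simp: eventually_sequentially)
    obtain \<delta> where \<delta>: "\<delta> > 0" "\<And>u. t \<le> u \<Longrightarrow> u < t + \<delta> \<Longrightarrow> ecdf (m j) (l j) u = ecdf (m j) (l j) t"
      using ecdf_right_constant by blast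
    have "dist (\<sigma> u) (\<sigma> t) < \<epsilon>" if "t < u" "u < t + \<delta>" for u
      using j[of u] j[of t] \<delta>(2)[of u] that unfolding dist_real_def by linarith
    then show "\<forall>\<^sub>F u in at_right t. dist (\<sigma> u) (\<sigma> t) < \<epsilon>"
      using \<delta>(1) by (auto simp: eventually_at_right_field intro!: exI[of _ "t + \<delta>"])
  qed
qed

text \<open>The average of \<open>f\<close> over the numbers \<open>l 0, \<dots>, l (n - 1)\<close>.\<close>

definition sample_mean :: "nat \<Rightarrow> (nat \<Rightarrow> real) \<Rightarrow> (real \<Rightarrow> real) \<Rightarrow> real" where
  "sample_mean n l f = (\<Sum>i<n. f (l i)) / real n"

lemma sample_mean_mono: "(\<And>i. i < n \<Longrightarrow> f (l i) \<le> g (l i)) \<Longrightarrow> sample_mean n l f \<le> sample_mean n l g"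
  unfolding sample_mean_def by (intro divide_right_mono sum_mono) auto

lemma sample_mean_near:
  assumes "0 < n" "\<And>i. i < n \<Longrightarrow> \<bar>f (l i) - g (l i)\<bar> \<le> \<epsilon>"
  shows "\<bar>sample_mean n l f - sample_mean n l g\<bar> \<le> \<epsilon>"
proof -
  have "\<bar>\<Sum>i<n. f (l i) - g (l i)\<bar> \<le> (\<Sum>i<n. \<epsilon>)"
    by (rule order_trans[OF sum_abs sum_mono]) (use assms in auto)
  then show ?thesis
    using assms(1)
    by (simp add: sample_mean_def sum_subtractf diff_divide_distrib[symmetric] divide_le_eq mult.commute)
qed

lemma ecdf_eq_sample_mean: "ecdf n l t = sample_mean n l (\<lambda>x. if x \<le> t then 1 else 0)"
proof -
  have "(\<Sum>i<n. if l i \<le> t then 1 else 0) = real (card ({..<n} \<inter> {i. l i \<le> t}))"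
    by (simp add: sum.If_cases)
  also have "{..<n} \<inter> {i. l i \<le> t} = {i. i < n \<and> l i \<le> t}" by auto
  finally show ?thesis by (simp add: sample_mean_def ecdf_def)
qed

text \<open>Convergence of the moments gives convergence of the averages of every continuous function, by
  polynomial approximation.\<close>

lemma sample_mean_continuous_convergent:
  assumes m: "\<And>j. 0 < m j"
    and bound: "\<And>j i. i < m j \<Longrightarrow> \<bar>l j i\<bar> \<le> M"
    and moments: "\<And>k. convergent (\<lambda>j. sample_mean (m j) (l j) (\<lambda>x. x ^ k))"
    and f: "continuous_on {-M..M} f"
  shows "convergent (\<lambda>j. sample_mean (m j) (l j) f)"
proof (rule Cauchy_convergent, rule metric_CauchyI)
  fix \<epsilon> :: real assume \<epsilon>: "0 < \<epsilon>"
  obtain p where p: "real_polynomial_function p" "\<And>x. x \<in> {-M..M} \<Longrightarrow> \<bar>f x - p x\<bar> < \<epsilon> / 3"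
    using Stone_Weierstrass_real_polynomial_function[OF compact_Icc f, of "\<epsilon> / 3"] \<epsilon> by auto
  obtain a d where pa: "p = (\<lambda>x. \<Sum>k\<le>d. a k * x ^ k)"
    using p(1) unfolding real_polynomial_function_iff_sum by blast
  have "sample_mean (m j) (l j) p = (\<Sum>k\<le>d. a k * sample_mean (m j) (l j) (\<lambda>x. x ^ k))" for j
    unfolding sample_mean_def pa sum_divide_distrib sum_distrib_left
    by (subst sum.swap) simp
  then have "convergent (\<lambda>j. sample_mean (m j) (l j) p)"
    by (simp only:) (intro convergent_sum convergent_mult convergent_const moments)
  then have "Cauchy (\<lambda>j. sample_mean (m j) (l j) p)" by (rule convergent_Cauchy)
  from metric_CauchyD[OF this, of "\<epsilon> / 3"] \<epsilon> obtain N where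
    "\<forall>i\<ge>N. \<forall>j\<ge>N. dist (sample_mean (m i) (l i) p) (sample_mean (m j) (l j) p) < \<epsilon> / 3" by auto
  then have N: "dist (sample_mean (m i) (l i) p) (sample_mean (m j) (l j) p) < \<epsilon> / 3"
    if "N \<le> i" "N \<le> j" for i j using that by blast
  have near: "\<bar>sample_mean (m j) (l j) f - sample_mean (m j) (l j) p\<bar> \<le> \<epsilon> / 3" for j
  proof (rule sample_mean_near[OF m])
    fix i assume "i < m j"
    then have "l j i \<in> {-M..M}" using bound by (auto simp: abs_le_iff minus_le_iff)
    then show "\<bar>f (l j i) - p (l j i)\<bar> \<le> \<epsilon> / 3" using p(2) less_imp_le by blast
  qed
  show "\<exists>N. \<forall>i\<ge>N. \<forall>j\<ge>N. dist (sample_mean (m i) (l i) f) (sample_mean (m j) (l j) f) < \<epsilon>"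
  proof (intro exI[of _ N] allI impI)
    fix i j assume "N \<le> i" "N \<le> j"
    then show "dist (sample_mean (m i) (l i) f) (sample_mean (m j) (l j) f) < \<epsilon>"
      using N[of i j] near[of i] near[of j] unfolding dist_real_def by linarith
  qed
qed

text \<open>For \<open>a < b\<close>: the continuous function that is 1 up to \<open>a\<close>, 0 from \<open>b\<close> on, and affine in
  between.\<close>

definition ramp :: "real \<Rightarrow> real \<Rightarrow> real \<Rightarrow> real" where
  "ramp a b x = max 0 (min 1 ((b - x) / (b - a)))"

lemma ramp_bounds:
  assumes "a < b"
  shows "(if x \<le> a then 1 else 0) \<le> ramp a b x" "ramp a b x \<le> (if x \<le> b then 1 else 0)"
proof -
  have "1 \<le> (b - x) / (b - a)" if "x \<le> a" using that assms by (simp add: le_divide_eq)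
  then show "(if x \<le> a then 1 else 0) \<le> ramp a b x" by (simp add: ramp_def)
  have "(b - x) / (b - a) \<le> 0" if "b < x"
    using that assms by (intro divide_nonpos_pos) auto
  then show "ramp a b x \<le> (if x \<le> b then 1 else 0)"
    by (cases "b < x") (simp_all add: ramp_def min.coboundedI2)
qed

lemma ecdf_le_ramp: "a < b \<Longrightarrow> ecdf n l a \<le> sample_mean n l (ramp a b)"
  and ramp_le_ecdf: "a < b \<Longrightarrow> sample_mean n l (ramp a b) \<le> ecdf n l b"
  unfolding ecdf_eq_sample_mean by (intro sample_mean_mono ramp_bounds; assumption)+

text \<open>Convergent moments alone give convergence only at continuity points of the limit. The gap
  assumption upgrades this to uniform convergence: up to \<open>\<epsilon>\<close>, eventually all the functions increase
  only at points of a finite set \<open>\<Lambda>\<close> independent of \<open>j\<close>. Between neighbouring points of \<open>\<Lambda>\<close> they are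
  therefore constant up to \<open>\<epsilon>\<close>, and the value there is, up to \<open>\<epsilon>\<close>, the average of a ramp function,
  which converges. Only finitely many ramps are involved.\<close>

theorem ecdf_uniform_limit_exists:
  assumes m: "\<And>j. 0 < m j"
    and bound: "\<And>j i. i < m j \<Longrightarrow> \<bar>l j i\<bar> \<le> M"
    and moments: "\<And>k. convergent (\<lambda>j. sample_mean (m j) (l j) (\<lambda>x. x ^ k))"
    and gap: "\<And>\<epsilon>. 0 < \<epsilon> \<Longrightarrow> \<exists>\<Lambda>. finite \<Lambda> \<and> (\<forall>\<^sub>F j in sequentially. \<forall>t u.
        t \<le> u \<longrightarrow> {t<..u} \<inter> \<Lambda> = {} \<longrightarrow> ecdf (m j) (l j) u \<le> ecdf (m j) (l j) t + \<epsilon>)"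
  shows "\<exists>\<sigma>. uniform_limit UNIV (\<lambda>j. ecdf (m j) (l j)) \<sigma> sequentially"
proof -
  let ?N = "\<lambda>j. ecdf (m j) (l j)"
  have "uniformly_Cauchy_on UNIV ?N"
    unfolding uniformly_Cauchy_on_def
  proof (intro allI impI)
    fix \<epsilon> :: real assume "0 < \<epsilon>"
    then obtain \<Lambda> where fin\<Lambda>: "finite \<Lambda>" and ev: "\<forall>\<^sub>F j in sequentially. \<forall>t u.
        t \<le> u \<longrightarrow> {t<..u} \<inter> \<Lambda> = {} \<longrightarrow> ?N j u \<le> ?N j t + \<epsilon> / 4"
      using gap[of "\<epsilon> / 4"] by auto
    from ev obtain N1 where N1: "\<And>j t u. j \<ge> N1 \<Longrightarrow> t \<le> u \<Longrightarrow> {t<..u} \<inter> \<Lambda> = {} \<Longrightarrow>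
        ?N j u \<le> ?N j t + \<epsilon> / 4"
      unfolding eventually_sequentially by blast
    \<comment> \<open>The two additional points enclose all the numbers, so each \<open>t\<close> between them has neighbours.\<close>
    define \<Lambda>' where "\<Lambda>' = insert (- \<bar>M\<bar> - 1) (insert (\<bar>M\<bar> + 1) \<Lambda>)"
    have fin: "finite \<Lambda>'" using fin\<Lambda> by (simp add: \<Lambda>'_def)
    define R where "R c c' j = sample_mean (m j) (l j) (ramp c ((c + c') / 2))" for c c' j
    have "\<exists>N. \<forall>i\<ge>N. \<forall>j\<ge>N. dist (R c c' i) (R c c' j) < \<epsilon> / 4" for c c'
    proof -
      have "convergent (R c c')"
        unfolding R_def
      proof (rule sample_mean_continuous_convergent[OF m bound moments])
        show "continuous_on {- M..M} (ramp c ((c + c') / 2))"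
          unfolding ramp_def divide_inverse by (intro continuous_intros)
      qed
      then have "Cauchy (R c c')" by (rule convergent_Cauchy)
      from metric_CauchyD[OF this, of "\<epsilon> / 4"] show ?thesis using \<open>0 < \<epsilon>\<close> by simp
    qed
    then obtain N2 where N2: "\<And>c c' i j. i \<ge> N2 c c' \<Longrightarrow> j \<ge> N2 c c' \<Longrightarrow>
        dist (R c c' i) (R c c' j) < \<epsilon> / 4" by metis
    define N3 where "N3 = Max (insert N1 ((\<lambda>(c, c'). N2 c c') ` (\<Lambda>' \<times> \<Lambda>')))"
    have N3: "N1 \<le> N3" "\<And>c c'. c \<in> \<Lambda>' \<Longrightarrow> c' \<in> \<Lambda>' \<Longrightarrow> N2 c c' \<le> N3"
      unfolding N3_def using fin by (auto intro!: Max_ge)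
    have main: "dist (?N i t) (?N j t) < \<epsilon>" if ij: "i \<ge> N3" "j \<ge> N3" for i j t
    proof -
      consider "t < - \<bar>M\<bar> - 1" | "- \<bar>M\<bar> - 1 \<le> t" "t < \<bar>M\<bar> + 1" | "\<bar>M\<bar> + 1 \<le> t" by linarith
      then show ?thesis
      proof cases
        case 1
        have "{i. i < m j \<and> l j i \<le> t} = {}" for j
          using 1 bound by (force simp: abs_le_iff)
        then have "?N j t = 0" for j unfolding ecdf_def by simp
        then show ?thesis using \<open>0 < \<epsilon>\<close> by simp
      next
        case 3
        have "{i. i < m j \<and> l j i \<le> t} = {..<m j}" for j
          using 3 bound by (force simp: abs_le_iff)
        then have "?N j t = 1" for j unfolding ecdf_def using m[of j] by simp
        then show ?thesis using \<open>0 < \<epsilon>\<close> by simp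
      next
        case 2
        define c where "c = Max {x \<in> \<Lambda>'. x \<le> t}"
        define c' where "c' = Min {x \<in> \<Lambda>'. t < x}"
        have "c \<in> {x \<in> \<Lambda>'. x \<le> t}" unfolding c_def
          by (rule Max_in) (use fin 2 in \<open>auto simp: \<Lambda>'_def\<close>)
        then have c: "c \<in> \<Lambda>'" "c \<le> t" by auto
        have "c' \<in> {x \<in> \<Lambda>'. t < x}" unfolding c'_def
          by (rule Min_in) (use fin 2 in \<open>auto simp: \<Lambda>'_def\<close>)
        then have c': "c' \<in> \<Lambda>'" "t < c'" by auto
        have below: "x \<le> c" if "x \<in> \<Lambda>'" "x \<le> t" for x
          unfolding c_def by (rule Max_ge) (use fin that in auto)
        have above: "c' \<le> x" if "x \<in> \<Lambda>'" "t < x" for x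
          unfolding c'_def by (rule Min_le) (use fin that in auto)
        have no: "{c<..u} \<inter> \<Lambda> = {}" if "u < c'" for u
        proof -
          have "x \<notin> \<Lambda>" if "c < x" "x \<le> u" for x
            using below[of x] above[of x] that \<open>u < c'\<close> unfolding \<Lambda>'_def by force
          then show ?thesis by auto
        qed
        define h where "h = (c + c') / 2"
        have h: "c < h" "h < c'" using c c' by (auto simp: h_def)
        have near: "\<bar>?N j t - R c c' j\<bar> \<le> \<epsilon> / 4" if j: "j \<ge> N3" for j
        proof -
          have "?N j t \<le> ?N j c + \<epsilon> / 4" "?N j c \<le> ?N j t"
            using N1[of j c t] j N3(1) c no[OF c'(2)] by (auto intro: ecdf_mono)
          moreover have "?N j c \<le> R c c' j" "R c c' j \<le> ?N j h"
            unfolding R_def h_def[symmetric] using h by (auto intro: ecdf_le_ramp ramp_le_ecdf)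
          moreover have "?N j h \<le> ?N j c + \<epsilon> / 4"
            using N1[of j c h] j N3(1) h no[OF h(2)] by auto
          ultimately show ?thesis by linarith
        qed
        have "dist (R c c' i) (R c c' j) < \<epsilon> / 4"
          using N2 N3(2)[OF c(1) c'(1)] ij by (meson order_trans)
        then show ?thesis using near[OF ij(1)] near[OF ij(2)] unfolding dist_real_def by linarith
      qed
    qed
    then show "\<exists>M. \<forall>x\<in>UNIV. \<forall>m\<ge>M. \<forall>n\<ge>M. dist (?N m x) (?N n x) < \<epsilon>"
      by blast
  qed
  then show ?thesis
    using Cauchy_uniformly_convergent unfolding uniformly_convergent_on_def by blast
qed

section \<open>Balls in colored graphs\<close>

text \<open>The vertices reached from \<open>x\<close> by a path of length at most \<open>r\<close>. For a vertex \<open>x\<close> of \<open>G\<close> this is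
  the vertex set of the ball, see \<open>gball_eq\<close>.\<close>

definition nbhd :: "('v, 'x, 's) xs_graph \<Rightarrow> nat \<Rightarrow> 'v \<Rightarrow> 'v set" where
  "nbhd G r x = {y. \<exists>k\<le>r. (x, y) \<in> edges G ^^ k}"

lemma nbhdI: "k \<le> r \<Longrightarrow> (x, y) \<in> edges G ^^ k \<Longrightarrow> y \<in> nbhd G r x"
  by (auto simp: nbhd_def)

lemma nbhdE:
  assumes "y \<in> nbhd G r x"
  obtains k where "k \<le> r" "(x, y) \<in> edges G ^^ k"
  using assms by (auto simp: nbhd_def)

lemma self_in_nbhd: "x \<in> nbhd G r x"
  by (rule nbhdI[of 0]) auto

lemma nbhd_mono: "r \<le> s \<Longrightarrow> nbhd G r x \<subseteq> nbhd G s x"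
  by (meson nbhdE nbhdI order_trans subsetI)

lemma nbhd_trans:
  assumes "y \<in> nbhd G r x" "z \<in> nbhd G s y"
  shows "z \<in> nbhd G (r + s) x"
proof -
  obtain k l where "k \<le> r" "(x, y) \<in> edges G ^^ k" "l \<le> s" "(y, z) \<in> edges G ^^ l"
    using assms by (auto elim!: nbhdE)
  then show ?thesis by (intro nbhdI[of "k + l"]) (auto simp: relpow_add)
qed

lemma gdist_le_iff: "gdist G x y \<le> enat r \<longleftrightarrow> y \<in> nbhd G r x"
proof
  let ?A = "{enat k |k. (x, y) \<in> edges G ^^ k}"
  assume le: "gdist G x y \<le> enat r"
  then have ne: "?A \<noteq> {}"
    unfolding gdist_def by (intro notI) (simp add: top_enat_def)
  then have "Inf ?A = (LEAST z. z \<in> ?A)" unfolding Inf_enat_def by (rule if_not_P)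
  also have "\<dots> \<in> ?A" using ne LeastI_ex[of "\<lambda>z. z \<in> ?A"] by blast
  finally obtain k where "Inf ?A = enat k" "(x, y) \<in> edges G ^^ k" by blast
  then show "y \<in> nbhd G r x" using le by (intro nbhdI[of k]) (simp_all add: gdist_def)
next
  assume "y \<in> nbhd G r x"
  then obtain k where k: "k \<le> r" "(x, y) \<in> edges G ^^ k" by (rule nbhdE)
  then have "gdist G x y \<le> enat k" unfolding gdist_def by (intro Inf_lower) blast
  then show "gdist G x y \<le> enat r" using k by (meson enat_ord_simps(1) order_trans)
qed

text \<open>The part of \<open>is_xs_graph\<close> that does not concern the colors, except for irreflexivity.\<close>

definition wf_graph :: "('v, 'x, 's) xs_graph \<Rightarrow> bool" where
  "wf_graph G \<longleftrightarrow> edges G \<subseteq> verts G \<times> verts G \<and> sym (edges G)"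

lemma is_xs_graph_wf_graph: "is_xs_graph X S G \<Longrightarrow> wf_graph G"
  by (simp add: is_xs_graph_def wf_graph_def)

lemma wf_graph_edgeD: "wf_graph G \<Longrightarrow> (x, y) \<in> edges G \<Longrightarrow> x \<in> verts G \<and> y \<in> verts G \<and> (y, x) \<in> edges G"
  by (auto simp: wf_graph_def dest: symD)

lemma relpow_symmetric: "sym R \<Longrightarrow> (x, y) \<in> R ^^ k \<Longrightarrow> (y, x) \<in> R ^^ k"
proof (induction k arbitrary: y)
  case (Suc k)
  then obtain z where "(x, z) \<in> R ^^ k" "(z, y) \<in> R" by auto
  then have "(z, x) \<in> R ^^ k" "(y, z) \<in> R" using Suc by (auto dest: symD)
  then show ?case by (rule relpow_Suc_I2[rotated])
qed auto

lemma nbhd_symmetric: "wf_graph G \<Longrightarrow> y \<in> nbhd G r x \<Longrightarrow> x \<in> nbhd G r y"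
  by (auto simp: nbhd_def wf_graph_def dest: relpow_symmetric)

lemma relpow_in_verts: "wf_graph G \<Longrightarrow> x \<in> verts G \<Longrightarrow> (x, y) \<in> edges G ^^ k \<Longrightarrow> y \<in> verts G"
  by (induction k arbitrary: y) (auto dest: wf_graph_edgeD)

lemma nbhd_subset_verts: "wf_graph G \<Longrightarrow> x \<in> verts G \<Longrightarrow> nbhd G r x \<subseteq> verts G"
  by (auto simp: nbhd_def dest: relpow_in_verts)

lemma nbhd_Suc: "nbhd G (Suc r) x = nbhd G r x \<union> (\<Union>y\<in>nbhd G r x. {z. (y, z) \<in> edges G})"
proof
  show "nbhd G (Suc r) x \<subseteq> nbhd G r x \<union> (\<Union>y\<in>nbhd G r x. {z. (y, z) \<in> edges G})"
  proof
    fix z assume "z \<in> nbhd G (Suc r) x"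
    then obtain k where k: "k \<le> Suc r" "(x, z) \<in> edges G ^^ k" by (rule nbhdE)
    show "z \<in> nbhd G r x \<union> (\<Union>y\<in>nbhd G r x. {z. (y, z) \<in> edges G})"
    proof (cases k)
      case 0
      then show ?thesis using k self_in_nbhd by auto
    next
      case (Suc j)
      then obtain y where "(x, y) \<in> edges G ^^ j" "(y, z) \<in> edges G" using k by auto
      then show ?thesis using k Suc nbhdI[of j r x y G] by auto
    qed
  qed
  have "z \<in> nbhd G (Suc r) x" if "y \<in> nbhd G r x" "(y, z) \<in> edges G" for y z
    using nbhd_trans[OF that(1) nbhdI[of 1 1 y z]] that(2) by simp
  then show "nbhd G r x \<union> (\<Union>y\<in>nbhd G r x. {z. (y, z) \<in> edges G}) \<subseteq> nbhd G (Suc r) x"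
    using nbhd_mono[of r "Suc r" G x] by auto
qed

lemma nbhd_card:
  assumes wf: "wf_graph G" and deg: "degrees_le d G" and x: "x \<in> verts G"
  shows "finite (nbhd G r x) \<and> card (nbhd G r x) \<le> (d + 1) ^ r"
proof (induction r)
  case 0
  have "nbhd G 0 x = {x}" by (auto simp: nbhd_def)
  then show ?case by simp
next
  case (Suc r)
  let ?N = "nbhd G r x" and ?F = "\<lambda>y. {z. (y, z) \<in> edges G}"
  have y: "finite (?F y)" "card (?F y) \<le> d" if "y \<in> ?N" for y
    using deg nbhd_subset_verts[OF wf x] that by (auto simp: degrees_le_def)
  have "card (\<Union>y\<in>?N. ?F y) \<le> (\<Sum>y\<in>?N. card (?F y))" using Suc.IH by (intro card_UN_le) simp
  also have "\<dots> \<le> (\<Sum>y\<in>?N. d)" by (intro sum_mono y)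
  also have "\<dots> \<le> (d + 1) ^ r * d" using Suc.IH by simp
  finally have "card (nbhd G (Suc r) x) \<le> (d + 1) ^ r + (d + 1) ^ r * d"
    unfolding nbhd_Suc using Suc.IH by (intro order_trans[OF card_Un_le] add_mono) auto
  moreover have "finite (nbhd G (Suc r) x)" unfolding nbhd_Suc using Suc.IH y by auto
  ultimately show ?case by (simp add: algebra_simps)
qed

lemmas nbhd_finite = nbhd_card[THEN conjunct1]
lemmas nbhd_card_le = nbhd_card[THEN conjunct2]

lemma spanned_simps [simp]:
  "verts (spanned G W) = W" "edges (spanned G W) = edges G \<inter> W \<times> W"
  "vcol (spanned G W) = vcol G" "ecol (spanned G W) = ecol G"
  by (auto simp: spanned_def)

lemma spanned_spanned: "U \<subseteq> W \<Longrightarrow> spanned (spanned G W) U = spanned G U"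
  unfolding spanned_def by (rule xs_graph.equality) auto

lemma wf_graph_spanned: "wf_graph G \<Longrightarrow> wf_graph (spanned G W)"
  by (auto simp: wf_graph_def sym_def)

lemma is_xs_graph_spanned: "is_xs_graph X S G \<Longrightarrow> W \<subseteq> verts G \<Longrightarrow> is_xs_graph X S (spanned G W)"
  by (fastforce simp: is_xs_graph_def sym_def irrefl_def)

lemma degrees_le_spanned:
  assumes "degrees_le d G" "W \<subseteq> verts G"
  shows "degrees_le d (spanned G W)"
  unfolding degrees_le_def
proof
  fix x assume "x \<in> verts (spanned G W)"
  then have f: "finite {y. (x, y) \<in> edges G}" "card {y. (x, y) \<in> edges G} \<le> d" "x \<in> W"
    using assms by (auto simp: degrees_le_def)
  have "{y. (x, y) \<in> edges (spanned G W)} \<subseteq> {y. (x, y) \<in> edges G}" by auto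
  then show "finite {y. (x, y) \<in> edges (spanned G W)} \<and>
      card {y. (x, y) \<in> edges (spanned G W)} \<le> d"
    using f card_mono finite_subset by (metis (no_types, lifting) order_trans)
qed

lemma gball_eq: "wf_graph G \<Longrightarrow> x \<in> verts G \<Longrightarrow> gball G r x = spanned G (nbhd G r x)"
  unfolding gball_def gdist_le_iff using nbhd_subset_verts[of G x r]
  by (intro arg_cong[of _ _ "spanned G"]) auto

lemma relpow_spanned_mono: "(x, y) \<in> edges (spanned G W) ^^ k \<Longrightarrow> (x, y) \<in> edges G ^^ k"
  by (induction k arbitrary: y) auto

lemma nbhd_spanned_subset: "nbhd (spanned G W) r x \<subseteq> nbhd G r x"
  by (meson nbhdE nbhdI relpow_spanned_mono subsetI)

lemma relpow_spanned:
  assumes "(x, y) \<in> edges G ^^ k" "nbhd G k x \<subseteq> W"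
  shows "(x, y) \<in> edges (spanned G W) ^^ k"
  using assms
proof (induction k arbitrary: y)
  case (Suc k)
  obtain z where z: "(x, z) \<in> edges G ^^ k" "(z, y) \<in> edges G" using Suc.prems(1) by auto
  have "nbhd G k x \<subseteq> W" using Suc.prems(2) nbhd_mono[of k "Suc k" G x] by auto
  then have "(x, z) \<in> edges (spanned G W) ^^ k" using Suc.IH z(1) by blast
  moreover have "z \<in> W" "y \<in> W"
    using Suc.prems nbhdI[of k "Suc k" x z G] nbhdI[of "Suc k" "Suc k" x y G] z by auto
  ultimately show ?case using z(2) by auto
qed auto

lemma nbhd_spanned: 
  assumes "nbhd G r x \<subseteq> W"
  shows "nbhd (spanned G W) r x = nbhd G r x"
proof
  show "nbhd G r x \<subseteq> nbhd (spanned G W) r x"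
  proof
    fix y assume "y \<in> nbhd G r x"
    then obtain k where k: "k \<le> r" "(x, y) \<in> edges G ^^ k" by (rule nbhdE)
    then have "(x, y) \<in> edges (spanned G W) ^^ k"
      using assms nbhd_mono[of k r G x] by (intro relpow_spanned) auto
    then show "y \<in> nbhd (spanned G W) r x" using k(1) by (rule nbhdI[rotated])
  qed
qed (rule nbhd_spanned_subset)

lemma gball_spanned:
  assumes wf: "wf_graph G" and W: "W \<subseteq> verts G" "x \<in> W" and nb: "nbhd G r x \<subseteq> W"
  shows "gball (spanned G W) r x = gball G r x"
  using assms by (subst (1 2) gball_eq)
    (auto simp: wf_graph_spanned nbhd_spanned spanned_spanned)

section \<open>Rooted isomorphisms\<close>

text \<open>Membership in \<open>rooted_graphs\<close>, for graphs over an arbitrary type of vertices.\<close>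

definition is_rooted ::
  "nat \<Rightarrow> nat \<Rightarrow> 'x set \<Rightarrow> 's set \<Rightarrow> ('v, 'x, 's) xs_graph \<Rightarrow> 'v \<Rightarrow> bool" where
  "is_rooted d r X S H x \<longleftrightarrow> is_xs_graph X S H \<and> finite (verts H) \<and> connected_graph H \<and>
     degrees_le d H \<and> x \<in> verts H \<and> (\<forall>y\<in>verts H. gdist H x y \<le> enat r)"

lemma rooted_graphs_iff: "(H, x) \<in> rooted_graphs d r X S \<longleftrightarrow> is_rooted d r X S H x"
  by (simp add: rooted_graphs_def is_rooted_def)

lemma relpow_rtrancl: "(x, y) \<in> R ^^ k \<Longrightarrow> (x, y) \<in> R\<^sup>*"
  by (rule relpow_imp_rtrancl)

lemma connected_if_nbhd:
  assumes "wf_graph H" "x \<in> verts H" "verts H \<subseteq> nbhd H r x"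
  shows "connected_graph H"
  unfolding connected_graph_def
proof (intro conjI ballI)
  fix u v assume "u \<in> verts H" "v \<in> verts H"
  then have "u \<in> nbhd H r x" "v \<in> nbhd H r x" using assms by auto
  then have "v \<in> nbhd H (r + r) u" using nbhd_trans nbhd_symmetric assms(1) by metis
  then show "(u, v) \<in> (edges H)\<^sup>*" by (auto elim!: nbhdE dest: relpow_rtrancl)
qed (use assms in auto)

lemma is_rootedI:
  assumes "is_xs_graph X S H" "finite (verts H)" "degrees_le d H" "x \<in> verts H"
    "verts H \<subseteq> nbhd H r x"
  shows "is_rooted d r X S H x"
  using assms connected_if_nbhd[OF is_xs_graph_wf_graph]
  by (auto simp: is_rooted_def gdist_le_iff)

lemma is_rooted_gball:
  assumes "is_xs_graph X S G" "degrees_le d G" "x \<in> verts G"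
  shows "is_rooted d r X S (gball G r x) x"
proof -
  have wf: "wf_graph G" using assms(1) by (rule is_xs_graph_wf_graph)
  show ?thesis
    unfolding gball_eq[OF wf assms(3)]
    using assms wf
    by (intro is_rootedI is_xs_graph_spanned degrees_le_spanned)
      (auto simp: nbhd_spanned self_in_nbhd nbhd_finite nbhd_subset_verts[THEN subsetD])
qed

lemma rooted_iso_iff:
  "rooted_iso \<phi> (G, x) (H, y) \<longleftrightarrow>
     bij_betw \<phi> (verts G) (verts H) \<and> \<phi> x = y \<and>
     (\<forall>u\<in>verts G. \<forall>v\<in>verts G. (u, v) \<in> edges G \<longleftrightarrow> (\<phi> u, \<phi> v) \<in> edges H) \<and>
     (\<forall>u\<in>verts G. vcol H (\<phi> u) = vcol G u) \<and>
     (\<forall>u v. (u, v) \<in> edges G \<longrightarrow> ecol H (\<phi> u, \<phi> v) = ecol G (u, v))"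
  by (auto simp: rooted_iso_def)

lemma rooted_iso_refl: "rooted_iso id (G, x) (G, x)"
  by (auto simp: rooted_iso_iff)

lemma rooted_iso_trans:
  assumes wf: "wf_graph G" and \<phi>: "rooted_iso \<phi> (G, x) (H, y)" and \<psi>: "rooted_iso \<psi> (H, y) (K, z)"
  shows "rooted_iso (\<psi> \<circ> \<phi>) (G, x) (K, z)"
proof -
  have mem: "\<phi> u \<in> verts H" if "u \<in> verts G" for u
    using \<phi> that by (auto simp: rooted_iso_iff bij_betw_def)
  have edge: "u \<in> verts G" "v \<in> verts G" "(\<phi> u, \<phi> v) \<in> edges H" if "(u, v) \<in> edges G" for u v
    using \<phi> wf_graph_edgeD[OF wf that] that by (auto simp: rooted_iso_iff)
  show ?thesis
    unfolding rooted_iso_iff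
  proof (intro conjI ballI allI impI)
    show "bij_betw (\<psi> \<circ> \<phi>) (verts G) (verts K)"
      using \<phi> \<psi> by (auto simp: rooted_iso_iff intro: bij_betw_trans)
    show "(\<psi> \<circ> \<phi>) x = z" using \<phi> \<psi> by (simp add: rooted_iso_iff)
    show "(u, v) \<in> edges G \<longleftrightarrow> ((\<psi> \<circ> \<phi>) u, (\<psi> \<circ> \<phi>) v) \<in> edges K"
      if "u \<in> verts G" "v \<in> verts G" for u v
      using \<phi> \<psi> mem that by (simp add: rooted_iso_iff)
    show "vcol K ((\<psi> \<circ> \<phi>) u) = vcol G u" if "u \<in> verts G" for u
      using \<phi> \<psi> mem that by (simp add: rooted_iso_iff)
    show "ecol K ((\<psi> \<circ> \<phi>) u, (\<psi> \<circ> \<phi>) v) = ecol G (u, v)" if "(u, v) \<in> edges G" for u v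
    proof -
      have "ecol K (\<psi> (\<phi> u), \<psi> (\<phi> v)) = ecol H (\<phi> u, \<phi> v)"
        using \<psi> edge(3)[OF that] by (simp add: rooted_iso_iff)
      then show ?thesis using \<phi> that by (simp add: rooted_iso_iff)
    qed
  qed
qed

lemma rooted_iso_sym:
  assumes wf: "wf_graph H" and x: "x \<in> verts G" and \<phi>: "rooted_iso \<phi> (G, x) (H, y)"
  shows "rooted_iso (inv_into (verts G) \<phi>) (H, y) (G, x)"
proof -
  let ?\<psi> = "inv_into (verts G) \<phi>"
  have bij: "bij_betw \<phi> (verts G) (verts H)" using \<phi> by (simp add: rooted_iso_iff)
  have mem: "?\<psi> u \<in> verts G" "\<phi> (?\<psi> u) = u" if "u \<in> verts H" for u
    using bij that by (auto simp: bij_betw_def inv_into_into f_inv_into_f)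
  have "?\<psi> y = x" using \<phi> x bij by (auto simp: rooted_iso_iff bij_betw_def)
  moreover have "(u, v) \<in> edges H \<longleftrightarrow> (?\<psi> u, ?\<psi> v) \<in> edges G"
    if "u \<in> verts H" "v \<in> verts H" for u v
    using \<phi> mem that unfolding rooted_iso_iff by metis
  moreover have "vcol G (?\<psi> u) = vcol H u" if "u \<in> verts H" for u
    using \<phi> mem that unfolding rooted_iso_iff by metis
  moreover have "ecol G (?\<psi> u, ?\<psi> v) = ecol H (u, v)" if "(u, v) \<in> edges H" for u v
    using \<phi> mem that wf_graph_edgeD[OF wf that] calculation(2) unfolding rooted_iso_iff by metis
  ultimately show ?thesis
    unfolding rooted_iso_iff using bij_betw_inv_into[OF bij] by blast
qed

lemma rooted_iso_relpow:
  assumes wf: "wf_graph G" and \<phi>: "rooted_iso \<phi> (G, x) (H, y)" and "(u, v) \<in> edges G ^^ k"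
  shows "(\<phi> u, \<phi> v) \<in> edges H ^^ k"
  using assms(3)
proof (induction k arbitrary: v)
  case (Suc k)
  then obtain w where w: "(u, w) \<in> edges G ^^ k" "(w, v) \<in> edges G" by auto
  then have "(\<phi> w, \<phi> v) \<in> edges H" using \<phi> wf_graph_edgeD[OF wf w(2)] by (auto simp: rooted_iso_iff)
  then show ?case using Suc.IH[OF w(1)] by auto
qed auto

lemma rooted_iso_nbhd:
  "wf_graph G \<Longrightarrow> rooted_iso \<phi> (G, x) (H, y) \<Longrightarrow> v \<in> nbhd G r u \<Longrightarrow> \<phi> v \<in> nbhd H r (\<phi> u)"
  by (auto elim!: nbhdE intro!: nbhdI dest: rooted_iso_relpow)

lemma is_rooted_wf_graph: "is_rooted d r X S H x \<Longrightarrow> wf_graph H"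
  by (auto simp: is_rooted_def dest: is_xs_graph_wf_graph)

lemma is_rooted_verts: "is_rooted d r X S H x \<Longrightarrow> verts H \<subseteq> nbhd H r x"
  by (auto simp: is_rooted_def gdist_le_iff)

lemma is_rooted_card:
  assumes "is_rooted d r X S H x"
  shows "card (verts H) \<le> (d + 1) ^ r"
proof -
  have "card (verts H) \<le> card (nbhd H r x)"
    using assms is_rooted_wf_graph[OF assms] is_rooted_verts[OF assms]
    by (intro card_mono nbhd_finite) (auto simp: is_rooted_def)
  also have "\<dots> \<le> (d + 1) ^ r"
    using assms is_rooted_wf_graph[OF assms] by (intro nbhd_card_le) (auto simp: is_rooted_def)
  finally show ?thesis .
qed

text \<open>The rooted graphs whose vertices form an initial segment of the naturals and whose coloring
  functions are \<open>undefined\<close> off the vertices and edges. There are finitely many, and every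
  rooted graph is isomorphic to one of them.\<close>

definition canonical_graphs ::
  "nat \<Rightarrow> nat \<Rightarrow> 'x set \<Rightarrow> 's set \<Rightarrow> ((nat, 'x, 's) xs_graph \<times> nat) set" where
  "canonical_graphs d r X S = {(H, x) \<in> rooted_graphs d r X S.
     verts H = {..<card (verts H)} \<and>
     vcol H \<in> extensional (verts H) \<and> ecol H \<in> extensional (edges H)}"

lemma finite_canonical_graphs:
  assumes "finite X" "finite S"
  shows "finite (canonical_graphs d r X S)"
proof -
  define N where "N = (d + 1) ^ r"
  let ?mk = "\<lambda>n E (vc, ec, x). (\<lparr>verts = {..<n}, edges = E, vcol = vc, ecol = ec\<rparr>, x)"
  let ?T = "\<Union>n\<in>{..N}. \<Union>E\<in>Pow ({..<N} \<times> {..<N}).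
     ?mk n E ` (({..<n} \<rightarrow>\<^sub>E X) \<times> (E \<rightarrow>\<^sub>E S) \<times> {..<n})"
  have "finite ?T"
    using assms by (intro finite_UN_I finite_imageI finite_cartesian_product finite_PiE
        finite_Pow_iff[THEN iffD2])
      (auto intro: finite_subset)
  moreover have "canonical_graphs d r X S \<subseteq> ?T"
  proof
    fix P assume "P \<in> canonical_graphs d r X S"
    then obtain H x where P: "P = (H, x)" and root: "is_rooted d r X S H x"
      and v: "verts H = {..<card (verts H)}"
      and ext: "vcol H \<in> extensional (verts H)" "ecol H \<in> extensional (edges H)"
      by (auto simp: canonical_graphs_def rooted_graphs_iff)
    define n where "n = card (verts H)"
    have n: "n \<le> N" using is_rooted_card[OF root] by (simp add: n_def N_def)
    have vn: "verts H = {..<n}" using v by (simp add: n_def)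
    have xs: "is_xs_graph X S H" and xn: "x < n" using root vn by (auto simp: is_rooted_def)
    have E: "edges H \<in> Pow ({..<N} \<times> {..<N})"
      using xs vn n by (fastforce simp: is_xs_graph_def)
    have "vcol H \<in> {..<n} \<rightarrow>\<^sub>E X" "ecol H \<in> edges H \<rightarrow>\<^sub>E S"
      using xs ext vn by (auto simp: is_xs_graph_def PiE_def)
    moreover have "P = ?mk n (edges H) (vcol H, ecol H, x)" using P vn by simp
    ultimately have "P \<in> ?mk n (edges H) ` (({..<n} \<rightarrow>\<^sub>E X) \<times> (edges H \<rightarrow>\<^sub>E S) \<times> {..<n})"
      using xn by (intro image_eqI[of _ _ "(vcol H, ecol H, x)"]) auto
    then show "P \<in> ?T" using n E by blast
  qed
  ultimately show ?thesis by (rule finite_subset[rotated])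
qed

lemma is_rooted_transport:
  assumes P: "is_rooted d r X S G x" and H: "is_xs_graph X S H" and \<phi>: "rooted_iso \<phi> (G, x) (H, y)"
  shows "is_rooted d r X S H y"
proof (rule is_rootedI)
  have wf: "wf_graph G" and bij: "bij_betw \<phi> (verts G) (verts H)" and root: "\<phi> x = y"
    using P \<phi> by (auto simp: rooted_iso_iff dest: is_rooted_wf_graph)
  have xG: "x \<in> verts G" and deg: "degrees_le d G" using P by (auto simp: is_rooted_def)
  show "is_xs_graph X S H" by (rule H)
  show "finite (verts H)" using P bij by (auto simp: is_rooted_def bij_betw_finite)
  show "y \<in> verts H" using bij xG root by (auto simp: bij_betw_def)
  have surj: "\<exists>u\<in>verts G. \<phi> u = v" if "v \<in> verts H" for v
    using bij that by (metis bij_betw_imp_surj_on imageE)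
  show "verts H \<subseteq> nbhd H r y"
    using surj is_rooted_verts[OF P] rooted_iso_nbhd[OF wf \<phi>] root by blast
  show "degrees_le d H"
    unfolding degrees_le_def
  proof
    fix v assume "v \<in> verts H"
    then obtain u where u: "u \<in> verts G" "\<phi> u = v" using surj by blast
    have *: "{w. (v, w) \<in> edges H} \<subseteq> \<phi> ` {w. (u, w) \<in> edges G}"
    proof
      fix w assume "w \<in> {w. (v, w) \<in> edges H}"
      then have w: "(v, w) \<in> edges H" by simp
      then obtain w' where w': "w' \<in> verts G" "\<phi> w' = w"
        using surj wf_graph_edgeD[OF is_xs_graph_wf_graph[OF H]] by blast
      then have "(u, w') \<in> edges G" using \<phi> u w by (auto simp: rooted_iso_iff)
      then show "w \<in> \<phi> ` {w. (u, w) \<in> edges G}" using w' by blast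
    qed
    have f: "finite {w. (u, w) \<in> edges G}" "card {w. (u, w) \<in> edges G} \<le> d"
      using deg u by (auto simp: degrees_le_def)
    have "card {w. (v, w) \<in> edges H} \<le> card {w. (u, w) \<in> edges G}"
      using * f(1) by (rule surj_card_le[rotated])
    then show "finite {w. (v, w) \<in> edges H} \<and> card {w. (v, w) \<in> edges H} \<le> d"
      using f finite_subset[OF * finite_imageI[OF f(1)]] by simp
  qed
qed

lemma canonical_copy:
  assumes P: "is_rooted d r X S G x"
  shows "\<exists>Q\<in>canonical_graphs d r X S. \<exists>\<phi>. rooted_iso \<phi> (G, x) Q"
proof -
  have fin: "finite (verts G)" and xG: "x \<in> verts G" and xs: "is_xs_graph X S G"
    using P by (auto simp: is_rooted_def)
  have wf: "wf_graph G" using P by (rule is_rooted_wf_graph)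
  define n where "n = card (verts G)"
  obtain f where f: "bij_betw f (verts G) {..<n}"
    using ex_bij_betw_finite_nat[OF fin] by (auto simp: n_def atLeast0LessThan)
  define g where "g = inv_into (verts G) f"
  have gf: "g (f u) = u" if "u \<in> verts G" for u
    using f that by (auto simp: g_def bij_betw_def)
  have fg: "f (g i) = i" "g i \<in> verts G" if "i < n" for i
    using f that by (auto simp: g_def bij_betw_def f_inv_into_f inv_into_into)
  have fn: "f u < n" if "u \<in> verts G" for u using f that by (auto simp: bij_betw_def)
  define E where "E = {(i, j). i < n \<and> j < n \<and> (g i, g j) \<in> edges G}"
  define H where "H = \<lparr>verts = {..<n}, edges = E, vcol = restrict (\<lambda>i. vcol G (g i)) {..<n},
    ecol = restrict (\<lambda>(i, j). ecol G (g i, g j)) E\<rparr>"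
  have iso: "rooted_iso f (G, x) (H, f x)"
    unfolding rooted_iso_iff
    using f fn gf wf_graph_edgeD[OF wf] by (auto simp: H_def E_def)
  have xsH: "is_xs_graph X S H"
    using xs fg unfolding is_xs_graph_def H_def E_def
    by (auto simp: sym_def irrefl_def image_subset_iff)
  have "is_rooted d r X S H (f x)" by (rule is_rooted_transport[OF P xsH iso])
  then have "(H, f x) \<in> canonical_graphs d r X S"
    by (auto simp: canonical_graphs_def rooted_graphs_iff H_def)
  then show ?thesis using iso by blast
qed

section \<open>Finiteness of the set of patches\<close>

text \<open>The isomorphism relation whose classes are the patches.\<close>

definition iso_rel ::
  "nat \<Rightarrow> nat \<Rightarrow> 'x set \<Rightarrow> 's set \<Rightarrow>
    (((nat, 'x, 's) xs_graph \<times> nat) \<times> ((nat, 'x, 's) xs_graph \<times> nat)) set" where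
  "iso_rel d r X S =
     {(P, Q) \<in> rooted_graphs d r X S \<times> rooted_graphs d r X S. \<exists>\<phi>. rooted_iso \<phi> P Q}"

lemma patches_eq: "patches d r X S = rooted_graphs d r X S // iso_rel d r X S"
  by (simp add: patches_def iso_rel_def)

lemma equiv_iso_rel: "equiv (rooted_graphs d r X S) (iso_rel d r X S)"
proof (rule equivI)
  show "iso_rel d r X S \<subseteq> rooted_graphs d r X S \<times> rooted_graphs d r X S"
    by (auto simp: iso_rel_def)
  show "refl_on (rooted_graphs d r X S) (iso_rel d r X S)"
    by (auto simp: refl_on_def iso_rel_def intro!: exI[of _ id] rooted_iso_refl)
  show "sym (iso_rel d r X S)"
  proof (rule symI)
    fix P Q assume PQ: "(P, Q) \<in> iso_rel d r X S"
    obtain G x H y where [simp]: "P = (G, x)" "Q = (H, y)" by (metis surj_pair)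
    have r: "is_rooted d r X S G x" "is_rooted d r X S H y"
      using PQ by (auto simp: iso_rel_def rooted_graphs_iff)
    obtain \<phi> where "rooted_iso \<phi> (G, x) (H, y)" using PQ by (auto simp: iso_rel_def)
    then have "rooted_iso (inv_into (verts G) \<phi>) (H, y) (G, x)"
      using r is_rooted_wf_graph by (intro rooted_iso_sym) (auto simp: is_rooted_def is_xs_graph_wf_graph)
    then show "(Q, P) \<in> iso_rel d r X S" using r by (auto simp: iso_rel_def rooted_graphs_iff)
  qed
  show "trans (iso_rel d r X S)"
  proof (rule transI)
    fix P Q R assume PQ: "(P, Q) \<in> iso_rel d r X S" and QR: "(Q, R) \<in> iso_rel d r X S"
    obtain G x H y K z where [simp]: "P = (G, x)" "Q = (H, y)" "R = (K, z)" by (metis surj_pair)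
    have r: "is_rooted d r X S G x" "is_rooted d r X S K z"
      using PQ QR by (auto simp: iso_rel_def rooted_graphs_iff)
    obtain \<phi> \<psi> where "rooted_iso \<phi> (G, x) (H, y)" "rooted_iso \<psi> (H, y) (K, z)"
      using PQ QR by (auto simp: iso_rel_def)
    then have "rooted_iso (\<psi> \<circ> \<phi>) (G, x) (K, z)"
      using r is_rooted_wf_graph by (intro rooted_iso_trans) auto
    then show "(P, R) \<in> iso_rel d r X S" using r by (auto simp: iso_rel_def rooted_graphs_iff)
  qed
qed

lemma finite_patches:
  assumes "finite X" "finite S"
  shows "finite (patches d r X S)"
proof (rule finite_subset)
  let ?R = "iso_rel d r X S"
  show "patches d r X S \<subseteq> (\<lambda>Q. ?R `` {Q}) ` canonical_graphs d r X S"
  proof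
    fix \<alpha> assume "\<alpha> \<in> patches d r X S"
    then obtain G x where P: "(G, x) \<in> rooted_graphs d r X S" "\<alpha> = ?R `` {(G, x)}"
      unfolding patches_eq by (metis quotientE surj_pair)
    obtain Q where Q: "Q \<in> canonical_graphs d r X S" "\<exists>\<phi>. rooted_iso \<phi> (G, x) Q"
      using canonical_copy[OF P(1)[unfolded rooted_graphs_iff]] by blast
    then have "((G, x), Q) \<in> ?R" using P by (auto simp: iso_rel_def canonical_graphs_def)
    then have "\<alpha> = ?R `` {Q}" using P equiv_class_eq[OF equiv_iso_rel] by blast
    then show "\<alpha> \<in> (\<lambda>Q. ?R `` {Q}) ` canonical_graphs d r X S" using Q(1) by blast
  qed
  show "finite ((\<lambda>Q. ?R `` {Q}) ` canonical_graphs d r X S)"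
    using finite_canonical_graphs[OF assms] by blast
qed

lemma represents_exists:
  assumes "is_rooted d r X S G x"
  shows "\<exists>\<alpha>\<in>patches d r X S. represents (G, x) \<alpha>"
proof -
  obtain Q \<phi> where Q: "Q \<in> canonical_graphs d r X S" "rooted_iso \<phi> (G, x) Q"
    using canonical_copy[OF assms] by blast
  have "Q \<in> rooted_graphs d r X S" using Q(1) by (auto simp: canonical_graphs_def)
  then have "iso_rel d r X S `` {Q} \<in> patches d r X S" "Q \<in> iso_rel d r X S `` {Q}"
    unfolding patches_eq using equiv_class_self[OF equiv_iso_rel] by (blast intro: quotientI)+
  then show ?thesis using Q(2) unfolding represents_def by blast
qed

lemma represents_unique:
  assumes root: "is_rooted d r X S G x" and \<alpha>: "\<alpha> \<in> patches d r X S" "represents (G, x) \<alpha>"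
    and \<beta>: "\<beta> \<in> patches d r X S" "represents (G, x) \<beta>"
  shows "\<alpha> = \<beta>"
proof -
  obtain H y \<phi> where P: "(H, y) \<in> \<alpha>" "rooted_iso \<phi> (G, x) (H, y)"
    using \<alpha>(2) unfolding represents_def by (metis surj_pair)
  obtain K z \<psi> where Q: "(K, z) \<in> \<beta>" "rooted_iso \<psi> (G, x) (K, z)"
    using \<beta>(2) unfolding represents_def by (metis surj_pair)
  have mem: "(H, y) \<in> rooted_graphs d r X S" "(K, z) \<in> rooted_graphs d r X S"
    using P(1) Q(1) \<alpha>(1) \<beta>(1) in_quotient_imp_subset[OF equiv_iso_rel] unfolding patches_eq by blast+
  then have wf: "wf_graph H" by (auto simp: rooted_graphs_iff dest: is_rooted_wf_graph)
  have "x \<in> verts G" using root by (simp add: is_rooted_def)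
  from rooted_iso_trans[OF wf rooted_iso_sym[OF wf this P(2)] Q(2)]
  have "((H, y), (K, z)) \<in> iso_rel d r X S" using mem by (auto simp: iso_rel_def)
  then show ?thesis
    using quotient_eqI[OF equiv_iso_rel] \<alpha>(1) \<beta>(1) P(1) Q(1) unfolding patches_eq by blast
qed

lemma represents_iso:
  assumes rG: "is_rooted d r X S G x" and rH: "is_rooted d r X S H y"
    and \<alpha>: "\<alpha> \<in> patches d r X S" "represents (G, x) \<alpha>" "represents (H, y) \<alpha>"
  shows "\<exists>\<phi>. rooted_iso \<phi> (G, x) (H, y)"
proof -
  obtain P Q where P: "P \<in> \<alpha>" "\<exists>\<phi>. rooted_iso \<phi> (G, x) P" and Q: "Q \<in> \<alpha>" "\<exists>\<phi>. rooted_iso \<phi> (H, y) Q"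
    using \<alpha>(2,3) unfolding represents_def by blast
  have "(P, Q) \<in> iso_rel d r X S"
    using in_quotient_imp_in_rel[OF equiv_iso_rel, of \<alpha>] \<alpha>(1) P Q unfolding patches_eq by blast
  then obtain \<eta> where \<eta>: "rooted_iso \<eta> P Q" and Qr: "Q \<in> rooted_graphs d r X S"
    by (auto simp: iso_rel_def)
  obtain P1 p Q1 q where [simp]: "P = (P1, p)" "Q = (Q1, q)" by (metis surj_pair)
  obtain \<phi> \<psi> where \<phi>: "rooted_iso \<phi> (G, x) (P1, p)" and \<psi>: "rooted_iso \<psi> (H, y) (Q1, q)"
    using P Q by auto
  have "wf_graph Q1" "y \<in> verts H" "wf_graph G"
    using Qr rG rH by (auto simp: rooted_graphs_iff is_rooted_def dest: is_xs_graph_wf_graph)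
  then have "rooted_iso (inv_into (verts H) \<psi>) (Q1, q) (H, y)" using \<psi> by (intro rooted_iso_sym)
  then have "rooted_iso (inv_into (verts H) \<psi> \<circ> (\<eta> \<circ> \<phi>)) (G, x) (H, y)"
    using \<open>wf_graph G\<close> \<phi> \<eta> by (auto intro!: rooted_iso_trans)
  then show ?thesis by blast
qed

text \<open>Finitely many vertices of \<open>G\<close> realize all isomorphism types of balls of radius \<open>r\<close>.\<close>

lemma finite_ball_representatives:
  assumes "finite X" "finite S" and G: "is_xs_graph X S G" "degrees_le d G"
  shows "\<exists>T\<subseteq>verts G. finite T \<and>
    (\<forall>x\<in>verts G. \<exists>t\<in>T. \<exists>\<phi>. rooted_iso \<phi> (gball G r x, x) (gball G r t, t))"
proof -
  let ?rep = "\<lambda>x \<alpha>. represents (gball G r x, x) \<alpha>"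
  define \<A> where "\<A> = {\<alpha> \<in> patches d r X S. \<exists>x\<in>verts G. ?rep x \<alpha>}"
  have "\<forall>\<alpha>\<in>\<A>. \<exists>t. t \<in> verts G \<and> ?rep t \<alpha>" by (auto simp: \<A>_def)
  then obtain t where t: "\<And>\<alpha>. \<alpha> \<in> \<A> \<Longrightarrow> t \<alpha> \<in> verts G \<and> ?rep (t \<alpha>) \<alpha>" by metis
  have "finite \<A>" using finite_patches[OF assms(1,2)] by (simp add: \<A>_def)
  moreover have "\<exists>u\<in>t ` \<A>. \<exists>\<phi>. rooted_iso \<phi> (gball G r x, x) (gball G r u, u)"
    if x: "x \<in> verts G" for x
  proof -
    obtain \<alpha> where \<alpha>: "\<alpha> \<in> patches d r X S" "?rep x \<alpha>"
      using represents_exists[OF is_rooted_gball[OF G x]] by blast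
    then have "\<alpha> \<in> \<A>" using x by (auto simp: \<A>_def)
    then show ?thesis
      using represents_iso[OF is_rooted_gball[OF G x] is_rooted_gball[OF G] \<alpha>] t by blast
  qed
  ultimately show ?thesis using t by (intro exI[of _ "t ` \<A>"]) auto
qed

section \<open>Boundaries\<close>

text \<open>The vertices at distance at most \<open>r\<close> from \<open>Z\<close>.\<close>

definition near :: "('v, 'x, 's) xs_graph \<Rightarrow> nat \<Rightarrow> 'v set \<Rightarrow> 'v set" where
  "near G r Z = (\<Union>z\<in>Z. nbhd G r z)"

lemma near_card:
  assumes "wf_graph G" "degrees_le d G" "Z \<subseteq> verts G" "finite Z"
  shows "finite (near G r Z)" "card (near G r Z) \<le> card Z * (d + 1) ^ r"
proof -
  have z: "finite (nbhd G r z)" "card (nbhd G r z) \<le> (d + 1) ^ r" if "z \<in> Z" for z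
    using nbhd_card[OF assms(1,2), of z r] that assms(3) by auto
  show "finite (near G r Z)" unfolding near_def using assms(4) z by blast
  have "card (near G r Z) \<le> (\<Sum>z\<in>Z. card (nbhd G r z))"
    unfolding near_def using assms(4) by (rule card_UN_le)
  also have "\<dots> \<le> (\<Sum>z\<in>Z. (d + 1) ^ r)" by (intro sum_mono z)
  finally show "card (near G r Z) \<le> card Z * (d + 1) ^ r" by simp
qed

lemma boundary_subset: "boundary G H \<subseteq> verts H"
  by (auto simp: boundary_def)

lemma exit_through_boundary:
  assumes wf: "wf_graph G" and x: "x \<in> verts H" "verts H \<subseteq> verts G"
    and y: "y \<in> nbhd G r x" "y \<notin> verts H"
  shows "x \<in> near G r (boundary G H)"
proof -
  obtain k where k: "k \<le> r" "(x, y) \<in> edges G ^^ k" using y(1) by (rule nbhdE)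
  have "\<exists>z\<in>boundary G H. \<exists>j\<le>k. (x, z) \<in> edges G ^^ j"
    using k(2) y(2)
  proof (induction k arbitrary: y)
    case 0
    then show ?case using x by auto
  next
    case (Suc k)
    then obtain z where z: "(x, z) \<in> edges G ^^ k" "(z, y) \<in> edges G" by auto
    show ?case
    proof (cases "z \<in> verts H")
      case True
      then have "z \<in> boundary G H"
        using z(2) Suc.prems wf_graph_edgeD[OF wf z(2)] by (auto simp: boundary_def)
      then show ?thesis using z(1) le_SucI by blast
    next
      case False
      then show ?thesis using Suc.IH[OF z(1)] le_SucI by blast
    qed
  qed
  then obtain z j where z: "z \<in> boundary G H" "j \<le> k" "(x, z) \<in> edges G ^^ j" by blast
  then have "z \<in> nbhd G r x" using k(1) by (intro nbhdI[of j]) auto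
  then show ?thesis using z(1) nbhd_symmetric[OF wf] unfolding near_def by blast
qed

lemma folnerD:
  assumes "folner_sequence G Gn"
  shows "verts (Gn n) \<subseteq> verts G" "Gn n = spanned G (verts (Gn n))" "finite (verts (Gn n))"
    "verts (Gn n) \<noteq> {}" "0 < card (verts (Gn n))"
    "(\<lambda>n. real (card (boundary G (Gn n))) / real (card (verts (Gn n)))) \<longlonglongrightarrow> 0"
proof -
  have "connected_graph (Gn n)" using assms by (auto simp: folner_sequence_def)
  then show "verts (Gn n) \<noteq> {}" by (simp add: connected_graph_def)
  then show "0 < card (verts (Gn n))" using assms by (simp add: folner_sequence_def card_gt_0_iff)
qed (use assms in \<open>auto simp: folner_sequence_def spanned_subgraph_def\<close>)

lemma undirected_edges_card:
  assumes "degrees_le d H" "finite (verts H)" "wf_graph H"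
  shows "finite (undirected_edges H)" "card (undirected_edges H) \<le> d * card (verts H)"
proof -
  let ?E = "SIGMA x:verts H. {y. (x, y) \<in> edges H}"
  have nb: "finite {y. (x, y) \<in> edges H}" "card {y. (x, y) \<in> edges H} \<le> d" if "x \<in> verts H" for x
    using assms(1) that by (auto simp: degrees_le_def)
  have E: "undirected_edges H = (\<lambda>(x, y). {x, y}) ` ?E"
    using wf_graph_edgeD[OF assms(3)] by (fastforce simp: undirected_edges_def)
  have fin: "finite ?E" using assms(2) nb by (intro finite_SigmaI) auto
  then show "finite (undirected_edges H)" unfolding E by (rule finite_imageI)
  have "card (undirected_edges H) \<le> card ?E" unfolding E using fin by (rule card_image_le)
  also have "\<dots> = (\<Sum>x\<in>verts H. card {y. (x, y) \<in> edges H})"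
    using assms(2) nb by (intro card_SigmaI) auto
  also have "\<dots> \<le> (\<Sum>x\<in>verts H. d)" by (intro sum_mono nb)
  finally show "card (undirected_edges H) \<le> d * card (verts H)" by (simp add: mult.commute)
qed

section \<open>Pattern-invariant operators\<close>

text \<open>A colored graph of bounded degree with finitely many colors, and a self-adjoint pattern-invariant
  kernel of range \<open>s\<close>.\<close>

locale pattern_operator =
  fixes X :: "'x set" and S :: "'s set" and G :: "('v, 'x, 's) xs_graph" and d :: nat
    and A :: "'v \<Rightarrow> 'v \<Rightarrow> real" and s :: nat
  assumes finX: "finite X" and finS: "finite S" and xs: "is_xs_graph X S G"
    and deg: "degrees_le d G" and sa: "self_adjoint_kernel G A"
    and range: "\<forall>x\<in>verts G. \<forall>y\<in>verts G. gdist G x y > enat s \<longrightarrow> A x y = 0"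
    and inv: "\<forall>x\<in>verts G. \<forall>x'\<in>verts G. \<forall>\<phi>.
      rooted_iso \<phi> (gball G s x, x) (gball G s x', x') \<longrightarrow>
        (\<forall>y\<in>verts (gball G s x). A x y = A (\<phi> x) (\<phi> y))"
begin

abbreviation "V \<equiv> verts G"

lemma wf: "wf_graph G" using xs by (rule is_xs_graph_wf_graph)

lemma A_zero: "x \<in> V \<Longrightarrow> y \<in> V \<Longrightarrow> y \<notin> nbhd G s x \<Longrightarrow> A x y = 0"
  using range gdist_le_iff[of G x y s] by (metis not_le)

lemma A_iso:
  "x \<in> V \<Longrightarrow> x' \<in> V \<Longrightarrow> rooted_iso \<phi> (gball G s x, x) (gball G s x', x') \<Longrightarrow>
    y \<in> nbhd G s x \<Longrightarrow> A x y = A (\<phi> x) (\<phi> y)"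
  using inv gball_eq[OF wf] by simp

lemma A_sym: "W \<subseteq> V \<Longrightarrow> \<forall>x\<in>W. \<forall>y\<in>W. A x y = A y x"
  using sa by (auto simp: self_adjoint_kernel_def)

lemmas nbhd_V = nbhd_subset_verts[OF wf]
lemmas fin_nbhd = nbhd_finite[OF wf deg]

lemma nbhd_in_V: "x \<in> V \<Longrightarrow> y \<in> nbhd G r x \<Longrightarrow> y \<in> V"
  using nbhd_V by blast

text \<open>Finitely many balls of radius \<open>s\<close> represent all of them, and the values of \<open>A\<close> within distance
  \<open>s\<close> are carried along isomorphisms of balls.\<close>

lemma finite_values: "finite {A x y |x y. x \<in> V \<and> y \<in> V}"
proof -
  obtain T where T: "T \<subseteq> V" "finite T"
    "\<forall>x\<in>V. \<exists>t\<in>T. \<exists>\<phi>. rooted_iso \<phi> (gball G s x, x) (gball G s t, t)"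
    using finite_ball_representatives[OF finX finS xs deg, of s] by auto
  have "{A x y |x y. x \<in> V \<and> y \<in> V} \<subseteq> insert 0 (\<Union>t\<in>T. A t ` nbhd G s t)"
  proof safe
    fix x y assume xy: "x \<in> V" "y \<in> V" and no: "A x y \<notin> (\<Union>t\<in>T. A t ` nbhd G s t)"
    show "A x y = 0"
    proof (rule A_zero[OF xy], rule notI)
      assume y: "y \<in> nbhd G s x"
      obtain t \<phi> where t: "t \<in> T" "rooted_iso \<phi> (gball G s x, x) (gball G s t, t)"
        using T(3) xy by blast
      then have tV: "t \<in> V" using T by blast
      have "A x y = A t (\<phi> y)"
        using A_iso[OF xy(1) tV t(2) y] t(2) by (simp add: rooted_iso_iff)
      moreover have "\<phi> y \<in> nbhd G s t"
        using t(2) y unfolding gball_eq[OF wf xy(1)] gball_eq[OF wf tV]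
        by (auto simp: rooted_iso_iff bij_betw_def)
      ultimately show False using no t(1) by blast
    qed
  qed
  moreover have "finite (nbhd G s t)" if "t \<in> T" for t using that T fin_nbhd by blast
  ultimately show ?thesis using T(2) by (meson finite_UN_I finite_imageI finite_insert finite_subset)
qed

lemma row_bound: "\<exists>c\<ge>0. \<forall>x\<in>V. \<forall>W\<subseteq>V. finite W \<longrightarrow> (\<Sum>y\<in>W. \<bar>A x y\<bar>) \<le> c"
proof -
  obtain a where a: "\<And>x y. x \<in> V \<Longrightarrow> y \<in> V \<Longrightarrow> \<bar>A x y\<bar> \<le> a"
    using finite_imp_bounded[OF finite_values] unfolding bounded_iff by auto
  define c where "c = \<bar>a\<bar> * real ((d + 1) ^ s)"
  have "(\<Sum>y\<in>W. \<bar>A x y\<bar>) \<le> c" if x: "x \<in> V" and W: "W \<subseteq> V" "finite W" for x W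
  proof -
    have "(\<Sum>y\<in>W. \<bar>A x y\<bar>) = (\<Sum>y\<in>W \<inter> nbhd G s x. \<bar>A x y\<bar>)"
      by (rule sum.mono_neutral_right) (use W x A_zero in auto)
    also have "\<dots> \<le> (\<Sum>y\<in>W \<inter> nbhd G s x. \<bar>a\<bar>)"
      by (rule sum_mono) (use W x a in \<open>fastforce intro: order_trans[OF _ abs_ge_self]\<close>)
    also have "\<dots> = real (card (W \<inter> nbhd G s x)) * \<bar>a\<bar>" by simp
    also have "\<dots> \<le> real ((d + 1) ^ s) * \<bar>a\<bar>"
    proof (intro mult_right_mono of_nat_mono)
      have "card (W \<inter> nbhd G s x) \<le> card (nbhd G s x)"
        by (rule card_mono) (use fin_nbhd[OF x] in auto)
      also have "\<dots> \<le> (d + 1) ^ s" by (rule nbhd_card_le[OF wf deg x])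
      finally show "card (W \<inter> nbhd G s x) \<le> (d + 1) ^ s" .
    qed simp
    finally show ?thesis by (simp add: c_def mult.commute)
  qed
  then show ?thesis by (intro exI[of _ c]) (auto simp: c_def)
qed

section \<open>Locality of kernel powers\<close>

text \<open>The \<open>k\<close>-th power has range \<open>k * s\<close>: its values at \<open>x\<close> depend only on the ball of that radius.\<close>

lemma kernel_pow_local:
  assumes "x \<in> V" "W \<subseteq> V" "finite W" "W' \<subseteq> V" "finite W'"
    "nbhd G (k * s) x \<subseteq> W" "nbhd G (k * s) x \<subseteq> W'"
  shows "kernel_pow W A k x y = kernel_pow W' A k x y"
  using assms(1,6,7)
proof (induction k arbitrary: x)
  case (Suc k)
  let ?N = "nbhd G s x"
  have N: "?N \<subseteq> nbhd G (Suc k * s) x" by (rule nbhd_mono) simp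
  have restrict: "(\<Sum>z\<in>U. A x z * kernel_pow U A k z y) = (\<Sum>z\<in>?N. A x z * kernel_pow U A k z y)"
    if "U \<subseteq> V" "finite U" "?N \<subseteq> U" for U
    by (rule sum.mono_neutral_right) (use that Suc.prems(1) A_zero in auto)
  have "kernel_pow W A k z y = kernel_pow W' A k z y" if z: "z \<in> ?N" for z
  proof (rule Suc.IH)
    show "z \<in> V" using nbhd_in_V[OF Suc.prems(1) z] .
    have "nbhd G (k * s) z \<subseteq> nbhd G (Suc k * s) x"
      using nbhd_trans[OF z] by auto
    then show "nbhd G (k * s) z \<subseteq> W" "nbhd G (k * s) z \<subseteq> W'" using Suc.prems by blast+
  qed
  then show ?case
    using restrict[of W] restrict[of W'] N Suc.prems assms(2-5) by simp
qed simp

lemma ball_iso_nbhd: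
  assumes x: "x \<in> V" "x' \<in> V" and \<phi>: "rooted_iso \<phi> (gball G R x, x) (gball G R x', x')"
    and sub: "nbhd G r u \<subseteq> nbhd G R x" and v: "v \<in> nbhd G r u"
  shows "\<phi> v \<in> nbhd G r (\<phi> u)"
proof -
  note \<phi>' = \<phi>[unfolded gball_eq[OF wf x(1)] gball_eq[OF wf x(2)]]
  have "v \<in> nbhd (spanned G (nbhd G R x)) r u" using v nbhd_spanned[OF sub] by simp
  from rooted_iso_nbhd[OF wf_graph_spanned[OF wf] \<phi>' this]
  show ?thesis using nbhd_spanned_subset by fast
qed

text \<open>An isomorphism of balls of radius \<open>R\<close> restricts to an isomorphism of balls of radius \<open>s\<close> around
  every vertex at distance at most \<open>R - s\<close> from the root, hence preserves the kernel there.\<close>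

lemma A_ball_iso:
  assumes x: "x \<in> V" "x' \<in> V" and \<phi>: "rooted_iso \<phi> (gball G R x, x) (gball G R x', x')"
    and u: "u \<in> nbhd G q x" and q: "q + s \<le> R" and v: "v \<in> nbhd G R x"
  shows "A u v = A (\<phi> u) (\<phi> v)"
proof -
  note \<phi>' = \<phi>[unfolded gball_eq[OF wf x(1)] gball_eq[OF wf x(2)]]
  define \<psi> where "\<psi> = inv_into (nbhd G R x) \<phi>"
  have bij: "bij_betw \<phi> (nbhd G R x) (nbhd G R x')" and root: "\<phi> x = x'"
    using \<phi>' by (auto simp: rooted_iso_iff)
  have \<psi>: "rooted_iso \<psi> (gball G R x', x') (gball G R x, x)"
    using rooted_iso_sym[OF wf_graph_spanned[OF wf] _ \<phi>'] self_in_nbhd[of x G R]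
    by (auto simp: \<psi>_def gball_eq[OF wf x(1)] gball_eq[OF wf x(2)])
  have \<psi>\<phi>: "\<psi> (\<phi> w) = w" if "w \<in> nbhd G R x" for w
    using bij that by (simp add: \<psi>_def bij_betw_def)
  have \<phi>\<psi>: "\<phi> (\<psi> w) = w" if "w \<in> nbhd G R x'" for w
    using bij that by (simp add: \<psi>_def bij_betw_def f_inv_into_f)
  have qR: "nbhd G q z \<subseteq> nbhd G R z" for z using q by (intro nbhd_mono) simp
  have sub: "nbhd G s w \<subseteq> nbhd G R z" if "w \<in> nbhd G q z" for w z
    using nbhd_trans[OF that] nbhd_mono[OF q, of G z] by blast
  have uR: "u \<in> nbhd G R x" using u qR by blast
  have uV: "u \<in> V" and vV: "v \<in> V" using nbhd_in_V[OF x(1)] u v by auto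
  have \<phi>u: "\<phi> u \<in> nbhd G q x'"
    using ball_iso_nbhd[OF x \<phi> qR u] root by simp
  have \<phi>uV: "\<phi> u \<in> V" using nbhd_in_V[OF x(2) \<phi>u] .
  have \<phi>vV: "\<phi> v \<in> V" using bij v nbhd_in_V[OF x(2)] by (auto simp: bij_betw_def)
  have to: "\<phi> w \<in> nbhd G s (\<phi> u)" if "w \<in> nbhd G s u" for w
    by (rule ball_iso_nbhd[OF x \<phi> sub[OF u] that])
  have from': "\<psi> w \<in> nbhd G s u" if "w \<in> nbhd G s (\<phi> u)" for w
    using ball_iso_nbhd[OF x(2,1) \<psi> sub[OF \<phi>u] that] \<psi>\<phi>[OF uR] by simp
  show ?thesis
  proof (cases "v \<in> nbhd G s u")
    case True
    have "rooted_iso \<phi> (gball G s u, u) (gball G s (\<phi> u), \<phi> u)"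
      unfolding gball_eq[OF wf uV] gball_eq[OF wf \<phi>uV] rooted_iso_iff
    proof (intro conjI ballI allI impI)
      have "\<phi> ` nbhd G s u = nbhd G s (\<phi> u)"
      proof
        show "nbhd G s (\<phi> u) \<subseteq> \<phi> ` nbhd G s u"
        proof
          fix w assume w: "w \<in> nbhd G s (\<phi> u)"
          then have "\<phi> (\<psi> w) = w" using \<phi>\<psi> sub[OF \<phi>u] by blast
          then show "w \<in> \<phi> ` nbhd G s u" using from'[OF w] by (metis imageI)
        qed
      qed (use to in auto)
      moreover have "inj_on \<phi> (nbhd G s u)"
        using bij sub[OF u] by (auto simp: bij_betw_def intro: inj_on_subset)
      ultimately show "bij_betw \<phi> (verts (spanned G (nbhd G s u))) (verts (spanned G (nbhd G s (\<phi> u))))"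
        by (simp add: bij_betw_def)
    next
      fix a b assume ab: "a \<in> verts (spanned G (nbhd G s u))" "b \<in> verts (spanned G (nbhd G s u))"
      then have "a \<in> nbhd G R x" "b \<in> nbhd G R x" using sub[OF u] by auto
      moreover from this have "\<phi> a \<in> nbhd G R x'" "\<phi> b \<in> nbhd G R x'"
        using bij by (auto simp: bij_betw_def)
      ultimately have "(a, b) \<in> edges G \<longleftrightarrow> (\<phi> a, \<phi> b) \<in> edges G"
        using \<phi>' by (simp add: rooted_iso_iff)
      then show "(a, b) \<in> edges (spanned G (nbhd G s u)) \<longleftrightarrow>
          (\<phi> a, \<phi> b) \<in> edges (spanned G (nbhd G s (\<phi> u)))"
        using ab to by simp
    qed (use \<phi>' subsetD[OF sub[OF u]] in \<open>auto simp: rooted_iso_iff\<close>)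
    then show ?thesis using A_iso[OF uV \<phi>uV _ True] by blast
  next
    case False
    have "\<phi> v \<notin> nbhd G s (\<phi> u)"
      using from'[of "\<phi> v"] \<psi>\<phi>[OF v] False by auto
    then show ?thesis using A_zero[OF uV vV False] A_zero[OF \<phi>uV \<phi>vV] by simp
  qed
qed

text \<open>Consequently the powers of \<open>A\<close>, computed inside a large enough ball, depend only on the
  isomorphism type of the ball.\<close>

lemma kernel_pow_ball_iso:
  assumes x: "x \<in> V" "x' \<in> V" and \<phi>: "rooted_iso \<phi> (gball G R x, x) (gball G R x', x')"
    and u: "u \<in> nbhd G q x" "q + k * s \<le> R" and y: "y \<in> nbhd G R x"
  shows "kernel_pow (nbhd G R x) A k u y = kernel_pow (nbhd G R x') A k (\<phi> u) (\<phi> y)"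
proof -
  have bij: "bij_betw \<phi> (nbhd G R x) (nbhd G R x')"
    using \<phi> by (simp add: rooted_iso_iff gball_eq[OF wf] x)
  show ?thesis
    using u
  proof (induction k arbitrary: q u)
    case 0
    then have "u \<in> nbhd G R x" using nbhd_mono[of q R G x] by auto
    then have "\<phi> u = \<phi> y \<longleftrightarrow> u = y"
      using bij y by (auto simp: bij_betw_def dest: inj_onD)
    then show ?case by simp
  next
    case (Suc k)
    have q: "q + s \<le> R" using Suc.prems(2) by simp
    have uV: "u \<in> V" using nbhd_in_V[OF x(1) Suc.prems(1)] .
    have "kernel_pow (nbhd G R x) A (Suc k) u y =
        (\<Sum>z\<in>nbhd G R x. A u z * kernel_pow (nbhd G R x) A k z y)"
      by simp
    also have "\<dots> = (\<Sum>z\<in>nbhd G R x. A (\<phi> u) (\<phi> z) * kernel_pow (nbhd G R x') A k (\<phi> z) (\<phi> y))"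
    proof (rule sum.cong[OF refl])
      fix z assume z: "z \<in> nbhd G R x"
      have eq: "A u z = A (\<phi> u) (\<phi> z)" by (rule A_ball_iso[OF x \<phi> Suc.prems(1) q z])
      show "A u z * kernel_pow (nbhd G R x) A k z y =
          A (\<phi> u) (\<phi> z) * kernel_pow (nbhd G R x') A k (\<phi> z) (\<phi> y)"
      proof (cases "z \<in> nbhd G s u")
        case True
        have "kernel_pow (nbhd G R x) A k z y = kernel_pow (nbhd G R x') A k (\<phi> z) (\<phi> y)"
          using Suc.prems by (intro Suc.IH[OF nbhd_trans[OF Suc.prems(1) True]]) simp
        then show ?thesis using eq by simp
      next
        case False
        then have "A u z = 0" using A_zero[OF uV nbhd_in_V[OF x(1) z]] by blast
        then show ?thesis using eq by simp
      qed
    qed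
    also have "\<dots> = (\<Sum>w\<in>nbhd G R x'. A (\<phi> u) w * kernel_pow (nbhd G R x') A k w (\<phi> y))"
      by (rule sum.reindex_bij_betw[OF bij])
    finally show ?case by simp
  qed
qed

lemma kernel_pow_bound:
  assumes c: "0 \<le> c" "\<And>x W. x \<in> V \<Longrightarrow> W \<subseteq> V \<Longrightarrow> finite W \<Longrightarrow> (\<Sum>y\<in>W. \<bar>A x y\<bar>) \<le> c"
    and W: "W \<subseteq> V" "finite W" and x: "x \<in> W"
  shows "\<bar>kernel_pow W A k x y\<bar> \<le> c ^ k"
  using x
proof (induction k arbitrary: x)
  case (Suc k)
  have "\<bar>kernel_pow W A (Suc k) x y\<bar> \<le> (\<Sum>z\<in>W. \<bar>A x z\<bar> * \<bar>kernel_pow W A k z y\<bar>)"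
    by (simp add: order_trans[OF sum_abs] abs_mult)
  also have "\<dots> \<le> (\<Sum>z\<in>W. \<bar>A x z\<bar> * c ^ k)"
    by (intro sum_mono mult_left_mono Suc.IH) auto
  also have "\<dots> \<le> c * c ^ k"
    unfolding sum_distrib_right[symmetric]
    using c(2)[of x W] c(1) W Suc.prems by (intro mult_right_mono) auto
  finally show ?case by simp
qed simp

section \<open>Convergence of the spectral moments\<close>

text \<open>The normalized trace of a power of \<open>A\<^sub>n\<close> is a linear combination of patch frequencies, up to the
  contribution of the vertices near the boundary.\<close>

lemma trace_convergent:
  assumes F: "folner_sequence G Gn" and wc: "weakly_convergent d X S Gn"
  shows "convergent (\<lambda>n.
    (\<Sum>x\<in>verts (Gn n). kernel_pow (verts (Gn n)) A k x x) / real (card (verts (Gn n))))"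
proof -
  \<comment> \<open>One more than the range of the power, as only radii \<open>r \<ge> 1\<close> are covered by weak convergence.\<close>
  define R where "R = k * s + 1"
  obtain c where c: "0 \<le> c" "\<And>x W. x \<in> V \<Longrightarrow> W \<subseteq> V \<Longrightarrow> finite W \<Longrightarrow> (\<Sum>y\<in>W. \<bar>A x y\<bar>) \<le> c"
    using row_bound by blast
  define q where "q x = kernel_pow (nbhd G R x) A k x x" for x
  define rep where "rep \<alpha> x \<longleftrightarrow> x \<in> V \<and> represents (gball G R x, x) \<alpha>" for \<alpha> x
  \<comment> \<open>\<open>h \<alpha>\<close> is the common diagonal value of the power of \<open>A\<close> at all vertices of \<open>G\<close> with patch \<open>\<alpha>\<close>.\<close>
  define h where "h \<alpha> = (if \<exists>x. rep \<alpha> x then q (SOME x. rep \<alpha> x) else 0)" for \<alpha>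
  let ?P = "patches d R X S"
  have finP: "finite ?P" by (rule finite_patches[OF finX finS])
  have q_bound: "\<bar>q x\<bar> \<le> c ^ k" if "x \<in> V" for x
    unfolding q_def
    by (rule kernel_pow_bound[OF c nbhd_V[OF that] fin_nbhd[OF that] self_in_nbhd])
  have h_bound: "\<bar>h \<alpha>\<bar> \<le> c ^ k" for \<alpha>
    using q_bound someI_ex[of "rep \<alpha>"] c(1) by (auto simp: h_def rep_def)
  have h_eq: "h \<alpha> = q x" if hx: "\<alpha> \<in> ?P" "rep \<alpha> x" for \<alpha> x
  proof -
    define t where "t = (SOME x. rep \<alpha> x)"
    have t: "rep \<alpha> t" unfolding t_def using hx(2) by (rule someI)
    then have tx: "t \<in> V" "x \<in> V" using hx(2) by (auto simp: rep_def)
    obtain \<phi> where \<phi>: "rooted_iso \<phi> (gball G R t, t) (gball G R x, x)"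
      using represents_iso[OF is_rooted_gball[OF xs deg tx(1)] is_rooted_gball[OF xs deg tx(2)] hx(1)]
        t hx(2) by (auto simp: rep_def)
    then have "\<phi> t = x" by (simp add: rooted_iso_iff)
    moreover have "q t = kernel_pow (nbhd G R x) A k (\<phi> t) (\<phi> t)"
      unfolding q_def
      by (rule kernel_pow_ball_iso[OF tx \<phi> self_in_nbhd[of t G 0] _ self_in_nbhd]) (simp add: R_def)
    ultimately show ?thesis using hx(2) by (auto simp: h_def q_def t_def)
  qed
  define T where "T n =
    (\<Sum>x\<in>verts (Gn n). kernel_pow (verts (Gn n)) A k x x) / real (card (verts (Gn n)))" for n
  define T' where "T' n = (\<Sum>\<alpha>\<in>?P. h \<alpha> * patch_freq R (Gn n) \<alpha>)" for n
  define C where "C = 2 * c ^ k * real ((d + 1) ^ R)"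
  have close: "\<bar>T n - T' n\<bar> \<le> C * (real (card (boundary G (Gn n))) / real (card (verts (Gn n))))" for n
  proof -
    define H where "H = Gn n"
    define W where "W = verts H"
    have W: "W \<subseteq> V" "H = spanned G W" "finite W" "0 < card W"
      using folnerD[OF F] by (auto simp: W_def H_def)
    define bad where "bad = near G R (boundary G H)"
    define ind where "ind x \<alpha> = (if represents (gball H R x, x) \<alpha> then 1 else 0 :: real)" for x \<alpha>
    define g where "g x = (\<Sum>\<alpha>\<in>?P. h \<alpha> * ind x \<alpha>)" for x
    have g_eq: "\<exists>\<alpha>\<in>?P. represents (gball H R x, x) \<alpha> \<and> g x = h \<alpha>" if x: "x \<in> W" for x
    proof -
      have root: "is_rooted d R X S (gball H R x) x"
        using x W xs deg by (intro is_rooted_gball) (auto intro!: is_xs_graph_spanned degrees_le_spanned)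
      obtain \<alpha> where \<alpha>: "\<alpha> \<in> ?P" "represents (gball H R x, x) \<alpha>"
        using represents_exists[OF root] by blast
      have "h \<beta> * ind x \<beta> = (if \<beta> = \<alpha> then h \<alpha> else 0)" if "\<beta> \<in> ?P" for \<beta>
      proof (cases "represents (gball H R x, x) \<beta>")
        case True
        then have "\<beta> = \<alpha>" by (rule represents_unique[OF root that _ \<alpha>])
        then show ?thesis using True by (simp add: ind_def)
      next
        case False
        then show ?thesis using \<alpha>(2) by (auto simp: ind_def)
      qed
      then have "g x = (\<Sum>\<beta>\<in>?P. if \<beta> = \<alpha> then h \<alpha> else 0)" by (simp add: g_def)
      then show ?thesis using \<alpha> finP by auto
    qed
    have pointwise: "\<bar>kernel_pow W A k x x - g x\<bar> \<le> (if x \<in> bad then 2 * c ^ k else 0)"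
      if x: "x \<in> W" for x
    proof (cases "x \<in> bad")
      case True
      have "\<bar>kernel_pow W A k x x\<bar> \<le> c ^ k" by (rule kernel_pow_bound[OF c W(1,3) x])
      moreover have "\<bar>g x\<bar> \<le> c ^ k" using g_eq[OF x] h_bound by auto
      ultimately show ?thesis using True by simp
    next
      case False
      have sub: "nbhd G R x \<subseteq> W"
        using exit_through_boundary[OF wf, of x H] False x W(1) by (auto simp: W_def bad_def)
      have xV: "x \<in> V" using x W by blast
      have "gball H R x = gball G R x"
        unfolding W(2) using wf W(1) x sub by (rule gball_spanned)
      then have "g x = q x" using g_eq[OF x] h_eq[of _ x] xV by (auto simp: rep_def)
      moreover have "nbhd G (k * s) x \<subseteq> nbhd G R x" by (rule nbhd_mono) (simp add: R_def)
      then have "kernel_pow W A k x x = q x"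
        unfolding q_def using sub xV W nbhd_V fin_nbhd by (intro kernel_pow_local) auto
      ultimately show ?thesis using False by simp
    qed
    have finB: "finite (boundary G H)" "boundary G H \<subseteq> V"
      using boundary_subset[of G H] W(1,3) finite_subset unfolding W_def by blast+
    have finbad: "finite bad" and cardbad: "card bad \<le> card (boundary G H) * (d + 1) ^ R"
      unfolding bad_def using near_card[OF wf deg finB(2,1)] by auto
    have "T' n = (\<Sum>x\<in>W. g x) / real (card W)"
    proof -
      have "patch_freq R H \<alpha> = (\<Sum>x\<in>W. ind x \<alpha>) / real (card W)" for \<alpha>
      proof -
        have "W \<inter> {x. represents (gball H R x, x) \<alpha>} = {z \<in> verts H. represents (gball H R z, z) \<alpha>}"
          by (auto simp: W_def)
        then show ?thesis
          using W(3) by (simp add: patch_freq_def ind_def sum.If_cases flip: W_def)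
      qed
      then have "T' n = (\<Sum>\<alpha>\<in>?P. \<Sum>x\<in>W. h \<alpha> * ind x \<alpha> / real (card W))"
        by (simp add: T'_def H_def[symmetric] sum_distrib_left sum_divide_distrib)
      also have "\<dots> = (\<Sum>x\<in>W. \<Sum>\<alpha>\<in>?P. h \<alpha> * ind x \<alpha> / real (card W))" by (rule sum.swap)
      finally show ?thesis by (simp add: g_def sum_divide_distrib)
    qed
    then have "\<bar>T n - T' n\<bar> = \<bar>\<Sum>x\<in>W. kernel_pow W A k x x - g x\<bar> / real (card W)"
      by (simp add: T_def H_def[symmetric] W_def[symmetric] sum_subtractf
          diff_divide_distrib[symmetric] abs_divide)
    also have "\<dots> \<le> (\<Sum>x\<in>W. if x \<in> bad then 2 * c ^ k else 0) / real (card W)"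
      by (intro divide_right_mono order_trans[OF sum_abs] sum_mono pointwise) auto
    also have "(\<Sum>x\<in>W. if x \<in> bad then 2 * c ^ k else 0) = real (card (W \<inter> bad)) * (2 * c ^ k)"
      using W(3) by (simp add: sum.If_cases)
    also have "\<dots> \<le> real (card (boundary G H) * (d + 1) ^ R) * (2 * c ^ k)"
    proof (intro mult_right_mono of_nat_mono)
      show "card (W \<inter> bad) \<le> card (boundary G H) * (d + 1) ^ R"
        using cardbad card_mono[OF finbad, of "W \<inter> bad"] by simp
    qed (use c(1) in simp)
    finally show ?thesis
      by (simp add: divide_right_mono C_def H_def[symmetric] W_def[symmetric] mult_ac)
  qed
  have "(\<lambda>n. C * (real (card (boundary G (Gn n))) / real (card (verts (Gn n))))) \<longlonglongrightarrow> C * 0"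
    by (intro tendsto_mult tendsto_const folnerD(6)[OF F])
  then have "(\<lambda>n. C * (real (card (boundary G (Gn n))) / real (card (verts (Gn n))))) \<longlonglongrightarrow> 0" by simp
  then have lim0: "(\<lambda>n. T n - T' n) \<longlonglongrightarrow> 0"
    by (rule Lim_null_comparison[rotated]) (use close in simp)
  have "convergent (\<lambda>n. patch_freq R (Gn n) \<alpha>)" if "\<alpha> \<in> ?P" for \<alpha>
    using wc that unfolding weakly_convergent_def by (simp add: R_def)
  then have "convergent T'"
    unfolding T'_def by (intro convergent_sum convergent_mult convergent_const)
  then obtain L where "T' \<longlonglongrightarrow> L" by (auto simp: convergent_def)
  from tendsto_add[OF lim0 this] have "T \<longlonglongrightarrow> L" by simp
  then show ?thesis unfolding convergent_def T_def by blast
qed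

section \<open>Antiexpanders concentrate the spectrum near a finite set\<close>

text \<open>Let \<open>B\<close> be \<open>A\<close> with all entries between different components of the graph without the edges in
  \<open>F\<close> set to zero. The eigenvalues of \<open>B\<close> are those of small matrices, so the number of eigenvalues of
  \<open>B\<close> up to \<open>t\<close> and up to \<open>u\<close> is the same. Moreover \<open>A\<close> and \<open>B\<close> agree off the set \<open>D\<close> of vertices
  within distance \<open>s\<close> of the boundary or of an endpoint of an edge in \<open>F\<close>: a path of length at most
  \<open>s\<close> that starts outside \<open>D\<close> stays inside \<open>W\<close> and uses no edge of \<open>F\<close>.\<close>

lemma block_decomposition:
  assumes W: "W \<subseteq> V" "finite W" and F: "F \<subseteq> undirected_edges (spanned G W)"
    and E: "eigenbasis W A e l"
    and comp: "\<And>x. x \<in> W \<Longrightarrow> card (component_of (remove_edges (spanned G W) F) x) \<le> K"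
    and tu: "t \<le> u" "{t<..u} \<inter> small_spectra {A x y |x y. x \<in> V \<and> y \<in> V} K = {}"
  shows "card {i. i < card W \<and> l i \<le> u} \<le> card {i. i < card W \<and> l i \<le> t} +
    2 * (card (boundary G (spanned G W)) + 2 * card F) * (d + 1) ^ s"
proof -
  let ?H = "remove_edges (spanned G W) F"
  let ?Vals = "{A x y |x y. x \<in> V \<and> y \<in> V}"
  define R where "R = (edges ?H)\<^sup>*"
  define B where "B = (\<lambda>x y. if (x, y) \<in> R then A x y else 0)"
  have "sym (edges ?H)"
    using wf by (auto simp: remove_edges_def sym_def wf_graph_def insert_commute)
  then have R: "equiv UNIV R"
    unfolding R_def by (intro equivI) (auto simp: refl_rtrancl sym_rtrancl trans_rtrancl)
  have comp_eq: "W \<inter> R `` {x} = component_of ?H x" for x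
    by (auto simp: component_of_def R_def remove_edges_def)
  have Bsym: "\<forall>x\<in>W. \<forall>y\<in>W. B x y = B y x"
    using A_sym[OF W(1)] R by (auto simp: B_def equiv_def dest: symD)
  obtain e' l' where E': "eigenbasis W B e' l'"
    using eigenbasis_exists[OF W(2) Bsym] by blast
  have spec: "l' i \<in> small_spectra ?Vals K" if "i < card W" for i
  proof -
    have "l' i \<in> eigenvalues W (kernel_op W B)"
      using that by (simp add: eigenvalues_eq[OF W(2) E' Bsym])
    from block_eigenvalue[OF R W(2) this[unfolded B_def]] obtain x where
      x: "x \<in> W" "l' i \<in> eigenvalues (W \<inter> R `` {x}) (kernel_op (W \<inter> R `` {x}) A)" by blast
    have "eigenvalues (W \<inter> R `` {x}) (kernel_op (W \<inter> R `` {x}) A) \<subseteq> small_spectra ?Vals K"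
    proof (rule eigenvalues_subset_small_spectra)
      show "card (W \<inter> R `` {x}) \<le> K" unfolding comp_eq by (rule comp[OF x(1)])
      show "\<forall>y\<in>W \<inter> R `` {x}. \<forall>z\<in>W \<inter> R `` {x}. A y z = A z y"
        using W(1) by (intro A_sym) auto
    qed (use W in auto)
    then show ?thesis using x by blast
  qed
  define Z where "Z = boundary G (spanned G W) \<union> \<Union>F"
  define D where "D = W \<inter> near G s Z"
  have wfW: "wf_graph (spanned G W)" by (rule wf_graph_spanned[OF wf])
  have finE: "finite (undirected_edges (spanned G W))"
    by (rule undirected_edges_card[OF degrees_le_spanned[OF deg W(1)]]) (simp_all add: W(2) wfW)
  then have finF: "finite F" using F finite_subset by blast
  have edgeF: "finite a \<and> card a \<le> 2 \<and> a \<subseteq> W" if "a \<in> F" for a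
    using F that by (auto simp: undirected_edges_def card_insert_if)
  have "card (\<Union>F) \<le> (\<Sum>a\<in>F. card a)" using card_Union_le_sum_card by blast
  also have "\<dots> \<le> (\<Sum>a\<in>F. 2)" by (intro sum_mono) (use edgeF in auto)
  finally have cardF: "card (\<Union>F) \<le> 2 * card F" by simp
  have Zsub: "Z \<subseteq> W" using edgeF boundary_subset[of G "spanned G W"] by (fastforce simp: Z_def)
  then have finZ: "finite Z" "Z \<subseteq> V" using W finite_subset by blast+
  have "card D \<le> card (near G s Z)"
    unfolding D_def by (intro card_mono near_card[OF wf deg finZ(2,1)]) auto
  also have "\<dots> \<le> card Z * (d + 1) ^ s" by (rule near_card[OF wf deg finZ(2,1)])
  also have "card Z \<le> card (boundary G (spanned G W)) + 2 * card F"
    unfolding Z_def using card_Un_le cardF by (meson add_left_mono order_trans)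
  finally have cardD: "card D \<le> (card (boundary G (spanned G W)) + 2 * card F) * (d + 1) ^ s"
    by simp
  have connected: "y \<in> W \<and> (x, y) \<in> R"
    if x: "x \<in> W" "x \<notin> D" and path: "k \<le> s" "(x, y) \<in> edges G ^^ k" for x y k
    using path
  proof (induction k arbitrary: y)
    case 0
    then show ?case using x by (auto simp: R_def)
  next
    case (Suc k)
    then obtain z where z: "(x, z) \<in> edges G ^^ k" "(z, y) \<in> edges G" by auto
    have zW: "z \<in> W" "(x, z) \<in> R" using Suc.IH[OF _ z(1)] Suc.prems by auto
    have "z \<in> nbhd G s x" using z(1) Suc.prems by (intro nbhdI[of k]) auto
    then have "z \<notin> Z"
      using x nbhd_symmetric[OF wf] unfolding D_def near_def by blast
    then have "y \<in> W" "{z, y} \<notin> F"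
      using zW z(2) wf_graph_edgeD[OF wf z(2)] by (auto simp: Z_def boundary_def)
    then have "(z, y) \<in> edges ?H" using zW z(2) by (simp add: remove_edges_def)
    then show ?case using \<open>y \<in> W\<close> zW(2) unfolding R_def by (meson rtrancl.rtrancl_into_rtrancl)
  qed
  have agree: "A x y = B x y" if xy: "x \<in> W - D" "y \<in> W - D" for x y
  proof (cases "y \<in> nbhd G s x")
    case True
    then have "(x, y) \<in> R" using connected[of x] xy by (auto elim!: nbhdE)
    then show ?thesis by (simp add: B_def)
  next
    case False
    then show ?thesis using A_zero xy W by (auto simp: B_def)
  qed
  have D: "D \<subseteq> W" by (simp add: D_def)
  have "{i. i < card W \<and> l' i \<le> u} = {i. i < card W \<and> l' i \<le> t}"
    using tu spec by (force simp: not_le)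
  then have "card {i. i < card W \<and> l i \<le> u} \<le> card {i. i < card W \<and> l' i \<le> t} + card D"
    using eigenvalue_count_perturbation[OF W(2) D E E' agree, of u] by simp
  also have "card {i. i < card W \<and> l' i \<le> t} \<le> card {i. i < card W \<and> l i \<le> t} + card D"
    using eigenvalue_count_perturbation[OF W(2) D E' E agree[symmetric], of t] by simp
  finally have "card {i. i < card W \<and> l i \<le> u} \<le> card {i. i < card W \<and> l i \<le> t} + 2 * card D"
    by simp
  also have "\<dots> \<le> card {i. i < card W \<and> l i \<le> t} +
      2 * ((card (boundary G (spanned G W)) + 2 * card F) * (d + 1) ^ s)"
    by (intro add_left_mono mult_left_mono cardD) simp
  finally show ?thesis by (simp only: mult.assoc)
qed

text \<open>The finite set consists of the eigenvalues of all symmetric matrices up to the size of the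
  components, with entries among the values of \<open>A\<close>. It does not depend on \<open>n\<close>.\<close>

lemma gap_condition:
  assumes Fo: "folner_sequence G Gn" and anti: "antiexpander d Gn"
    and E: "\<And>n. eigenbasis (verts (Gn n)) A (e n) (l n)" and \<epsilon>: "0 < \<epsilon>"
  shows "\<exists>\<Lambda>. finite \<Lambda> \<and> (\<forall>\<^sub>F n in sequentially. \<forall>t u. t \<le> u \<longrightarrow> {t<..u} \<inter> \<Lambda> = {} \<longrightarrow>
    ecdf (card (verts (Gn n))) (l n) u \<le> ecdf (card (verts (Gn n))) (l n) t + \<epsilon>)"
proof -
  define N where "N = real ((d + 1) ^ s)"
  have N: "0 < N" by (simp add: N_def)
  \<comment> \<open>The exceptional vertices near deleted edges then number at most \<open>\<epsilon> / 4 * card W\<close>.\<close>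
  define \<delta> where "\<delta> = \<epsilon> / (8 * N * real (d + 1))"
  have \<delta>: "0 < \<delta>" using \<epsilon> N by (simp add: \<delta>_def)
  then obtain K where K: "\<And>n. \<exists>F\<subseteq>undirected_edges (Gn n).
      real (card F) \<le> \<delta> * real (card (undirected_edges (Gn n))) \<and>
      (\<forall>x\<in>verts (Gn n). card (component_of (remove_edges (Gn n) F) x) \<le> K)"
    using anti unfolding antiexpander_def by metis
  define \<Lambda> where "\<Lambda> = small_spectra {A x y |x y. x \<in> V \<and> y \<in> V} K"
  have "finite \<Lambda>" unfolding \<Lambda>_def by (rule finite_small_spectra[OF finite_values])
  moreover have "\<forall>\<^sub>F n in sequentially.
      real (card (boundary G (Gn n))) / real (card (verts (Gn n))) < \<epsilon> / (4 * N)"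
    using order_tendstoD(2)[OF folnerD(6)[OF Fo], of "\<epsilon> / (4 * N)"] \<epsilon> N by simp
  then have "\<forall>\<^sub>F n in sequentially. \<forall>t u. t \<le> u \<longrightarrow> {t<..u} \<inter> \<Lambda> = {} \<longrightarrow>
    ecdf (card (verts (Gn n))) (l n) u \<le> ecdf (card (verts (Gn n))) (l n) t + \<epsilon>"
  proof (rule eventually_mono, intro allI impI)
    fix n t u
    assume bd: "real (card (boundary G (Gn n))) / real (card (verts (Gn n))) < \<epsilon> / (4 * N)"
      and tu: "t \<le> u" "{t<..u} \<inter> \<Lambda> = {}"
    define W where "W = verts (Gn n)"
    have W: "W \<subseteq> V" "finite W" "Gn n = spanned G W" "0 < card W"
      using folnerD[OF Fo] by (auto simp: W_def)
    obtain F where F: "F \<subseteq> undirected_edges (spanned G W)"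
      "real (card F) \<le> \<delta> * real (card (undirected_edges (spanned G W)))"
      "\<And>x. x \<in> W \<Longrightarrow> card (component_of (remove_edges (spanned G W) F) x) \<le> K"
      using K[of n] unfolding W(3) by auto
    let ?b = "real (card (boundary G (spanned G W)))" and ?f = "real (card F)"
    have b: "?b * N \<le> \<epsilon> / 4 * real (card W)"
      using bd N W(4) unfolding W_def[symmetric] W(3) by (simp add: field_simps)
    have "card (undirected_edges (spanned G W)) \<le> d * card (verts (spanned G W))"
      using W by (intro undirected_edges_card degrees_le_spanned[OF deg] wf_graph_spanned[OF wf]) auto
    then have "real (card (undirected_edges (spanned G W))) \<le> real (d + 1) * real (card W)"
      unfolding of_nat_mult[symmetric] of_nat_le_iff by simp
    then have "?f \<le> \<delta> * (real (d + 1) * real (card W))"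
      using F(2) \<delta> by (meson less_imp_le mult_left_mono order_trans)
    then have "?f * N \<le> \<delta> * (real (d + 1) * real (card W)) * N"
      using N by (simp add: mult_right_mono)
    also have "\<dots> = \<epsilon> / 8 * real (card W)"
    proof -
      have "\<epsilon> / (8 * N * p) * (p * w) * N = \<epsilon> / 8 * w" if "0 < p" for p w :: real
        using that N by (simp add: field_simps)
      from this[of "real (d + 1)"] show ?thesis unfolding \<delta>_def by simp
    qed
    finally have f: "?f * N \<le> \<epsilon> / 8 * real (card W)" .
    have E': "eigenbasis W A (e n) (l n)" using E[of n] by (simp add: W_def)
    have "real (card {i. i < card W \<and> l n i \<le> u}) \<le> real (card {i. i < card W \<and> l n i \<le> t} +
        2 * (card (boundary G (spanned G W)) + 2 * card F) * (d + 1) ^ s)"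
      by (intro of_nat_mono block_decomposition[OF W(1,2) F(1) E' F(3) tu(1)])
        (use tu(2) in \<open>simp_all add: \<Lambda>_def\<close>)
    also have "\<dots> = real (card {i. i < card W \<and> l n i \<le> t}) + 2 * (?b * N + 2 * (?f * N))"
      by (simp add: N_def algebra_simps)
    also have "\<dots> \<le> real (card {i. i < card W \<and> l n i \<le> t}) + \<epsilon> * real (card W)"
      using b f by simp
    finally have "ecdf (card W) (l n) u \<le>
        (real (card {i. i < card W \<and> l n i \<le> t}) + \<epsilon> * real (card W)) / real (card W)"
      unfolding ecdf_def by (intro divide_right_mono) auto
    also have "\<dots> = ecdf (card W) (l n) t + \<epsilon>"
      using W(4) by (simp add: ecdf_def add_divide_distrib)
    finally show "ecdf (card (verts (Gn n))) (l n) u \<le> ecdf (card (verts (Gn n))) (l n) t + \<epsilon>"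
      unfolding W_def .
  qed
  ultimately show ?thesis by blast
qed

theorem spectral_distribution_limit:
  assumes Fo: "folner_sequence G Gn" and wc: "weakly_convergent d X S Gn"
    and anti: "antiexpander d Gn"
  shows "\<exists>\<sigma>. uniform_limit UNIV
      (\<lambda>n. spectral_distribution (verts (Gn n)) (finite_volume A (Gn n))) \<sigma> sequentially \<and>
    mono \<sigma> \<and> (\<forall>t. continuous (at_right t) \<sigma>)"
proof -
  let ?W = "\<lambda>n. verts (Gn n)"
  note W = folnerD[OF Fo]
  have sym: "\<forall>x\<in>?W n. \<forall>y\<in>?W n. A x y = A y x" for n by (rule A_sym[OF W(1)])
  obtain e l where E: "\<And>n. eigenbasis (?W n) A (e n) (l n)"
    using eigenbasis_exists[OF W(3) sym] by metis
  obtain c where c: "0 \<le> c" "\<And>x W. x \<in> V \<Longrightarrow> W \<subseteq> V \<Longrightarrow> finite W \<Longrightarrow> (\<Sum>y\<in>W. \<bar>A x y\<bar>) \<le> c"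
    using row_bound by blast
  have "\<exists>\<sigma>. uniform_limit UNIV (\<lambda>n. ecdf (card (?W n)) (l n)) \<sigma> sequentially"
  proof (rule ecdf_uniform_limit_exists)
    show "0 < card (?W n)" for n by (rule W(5))
    show "\<bar>l n i\<bar> \<le> c" if "i < card (?W n)" for n i
    proof (rule eigenvalue_bound[OF W(3) E that])
      fix x assume "x \<in> ?W n"
      then show "(\<Sum>y\<in>?W n. \<bar>A x y\<bar>) \<le> c" using W(1,3) by (intro c(2)) auto
    qed
    show "convergent (\<lambda>n. sample_mean (card (?W n)) (l n) (\<lambda>x. x ^ k))" for k
      unfolding sample_mean_def trace_eigenbasis[OF W(3) E] by (rule trace_convergent[OF Fo wc])
  qed (rule gap_condition[OF Fo anti E])
  then obtain \<sigma> where \<sigma>: "uniform_limit UNIV (\<lambda>n. ecdf (card (?W n)) (l n)) \<sigma> sequentially" ..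
  moreover have "spectral_distribution (?W n) (finite_volume A (Gn n)) = ecdf (card (?W n)) (l n)" for n
    unfolding finite_volume_eq_kernel_op by (rule spectral_distribution_eq[OF W(3) E sym])
  ultimately show ?thesis using uniform_limit_ecdf[OF \<sigma>] by (intro exI[of _ \<sigma>]) simp
qed

end

section \<open>Independence of the sequence\<close>

text \<open>The sequence \<open>f 0, g 0, f 1, g 1, \<dots>\<close>.\<close>

definition interleave :: "(nat \<Rightarrow> 'a) \<Rightarrow> (nat \<Rightarrow> 'a) \<Rightarrow> nat \<Rightarrow> 'a" where
  "interleave f g n = (if even n then f (n div 2) else g (n div 2))"

lemma interleave_simps [simp]: "interleave f g (2 * n) = f n" "interleave f g (Suc (2 * n)) = g n"
  by (auto simp: interleave_def)

lemma interleave_tendsto: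
  fixes f g :: "nat \<Rightarrow> real"
  assumes "f \<longlonglongrightarrow> L" "g \<longlonglongrightarrow> L"
  shows "interleave f g \<longlonglongrightarrow> L"
proof (rule tendstoI)
  fix \<epsilon> :: real assume "0 < \<epsilon>"
  have half: "filterlim (\<lambda>n::nat. n div 2) sequentially sequentially"
    by (rule filterlim_at_top_div_const_nat) simp
  have "\<forall>\<^sub>F n in sequentially. dist (f (n div 2)) L < \<epsilon>"
    "\<forall>\<^sub>F n in sequentially. dist (g (n div 2)) L < \<epsilon>"
    using tendstoD[OF filterlim_compose[OF assms(1) half] \<open>0 < \<epsilon>\<close>]
      tendstoD[OF filterlim_compose[OF assms(2) half] \<open>0 < \<epsilon>\<close>] by simp_all
  then show "\<forall>\<^sub>F n in sequentially. dist (interleave f g n) L < \<epsilon>"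
    by eventually_elim (simp add: interleave_def)
qed

lemma folner_interleave:
  assumes f: "folner_sequence G f" and g: "folner_sequence G g"
  shows "folner_sequence G (interleave f g)"
  unfolding folner_sequence_def
proof
  let ?r = "\<lambda>H. real (card (boundary G H)) / real (card (verts H))"
  have "(\<lambda>n. ?r (interleave f g n)) = interleave (\<lambda>n. ?r (f n)) (\<lambda>n. ?r (g n))"
    by (auto simp: interleave_def)
  then show "(\<lambda>n. ?r (interleave f g n)) \<longlonglongrightarrow> 0"
    using f g by (simp add: folner_sequence_def interleave_tendsto)
qed (use f g in \<open>auto simp: folner_sequence_def interleave_def\<close>)

lemma uniform_limit_subseq:
  assumes "uniform_limit S f L sequentially" "filterlim r sequentially sequentially"
  shows "uniform_limit S (\<lambda>n. f (r n)) L sequentially"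
  using assms unfolding uniform_limit_iff filterlim_iff by blast

theorem theorem2:
  fixes X :: "'x set" and S :: "'s set" and G :: "('v, 'x, 's) xs_graph"
    and d :: nat and A :: "'v \<Rightarrow> 'v \<Rightarrow> real"
  assumes "finite X" and "finite S"
    and "is_xs_graph X S G" and "infinite (verts G)" and "connected_graph G"
    and "degrees_le d G"
    and "upf_antiexpander d X S G"
    and "self_adjoint_kernel G A" and "finite_range_pattern_invariant G A"
  shows "\<exists>\<sigma> :: real \<Rightarrow> real. mono \<sigma> \<and> (\<forall>t. continuous (at_right t) \<sigma>) \<and>
    (\<forall>Gn. folner_sequence G Gn \<longrightarrow>
      uniform_limit UNIV (\<lambda>n. spectral_distribution (verts (Gn n)) (finite_volume A (Gn n)))
        \<sigma> sequentially)"
proof -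
  obtain s where "pattern_operator X S G d A s"
    using assms unfolding finite_range_pattern_invariant_def pattern_operator_def by blast
  then interpret pattern_operator X S G d A s .
  let ?N = "\<lambda>Gn n. spectral_distribution (verts (Gn n)) (finite_volume A (Gn n))"
  have limit: "\<exists>\<sigma>. uniform_limit UNIV (?N Gn) \<sigma> sequentially \<and>
      mono \<sigma> \<and> (\<forall>t. continuous (at_right t) \<sigma>)" if "folner_sequence G Gn" for Gn
    using spectral_distribution_limit that assms(7) unfolding upf_antiexpander_def by blast
  obtain G0 where G0: "folner_sequence G G0"
    using assms(7) unfolding upf_antiexpander_def amenable_def by blast
  obtain \<sigma> where \<sigma>: "uniform_limit UNIV (?N G0) \<sigma> sequentially" "mono \<sigma>"
    "\<forall>t. continuous (at_right t) \<sigma>" using limit[OF G0] by blast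
  have "uniform_limit UNIV (?N Gn) \<sigma> sequentially" if Gn: "folner_sequence G Gn" for Gn
  proof -
    obtain \<tau> where \<tau>: "uniform_limit UNIV (?N (interleave G0 Gn)) \<tau> sequentially"
      using limit[OF folner_interleave[OF G0 Gn]] by blast
    have "uniform_limit UNIV (?N G0) \<tau> sequentially"
      using uniform_limit_subseq[OF \<tau>, of "\<lambda>n. 2 * n"]
      by (simp add: filterlim_subseq strict_mono_def)
    then have "\<tau> t = \<sigma> t" for t
      by (intro LIMSEQ_unique[OF tendsto_uniform_limitI tendsto_uniform_limitI[OF \<sigma>(1)]]) auto
    then have "\<tau> = \<sigma>" by blast
    then show ?thesis
      using uniform_limit_subseq[OF \<tau>, of "\<lambda>n. Suc (2 * n)"]
      by (simp add: filterlim_subseq strict_mono_def)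
  qed
  then show ?thesis using \<sigma>(2,3) by blast
qed

end
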